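(* Let $d,m\in\mathbb{N}$ with $d\ge3$, and let $1<q<(d-1)^{1/d}$. There exist a Hilbert space $H$ and $f\in\mathscr{P}^m_d(H)$ such that for every $r>0$ the set $K_r=\mathrm{Crit}(f)\cap B_H(r)$ is compact and satisfies $\limsup_{n\to\infty}\Omega_n(K_r,H)^{1/n}\le q^{-1}$, and such that $f$ does not have the Sard property on these sets: $\mu\big(f(\mathrm{Crit}(f)\cap K_r)\big)>0$ for some $r>0$. Consequently, any constant $\beta_0(d,m)>1$ with the property that for every Hilbert space $H$, every compact $K\subset H$ and every $q>\beta_0$ with $\limsup_n\Omega_n(K,H)^{1/n}\le q^{-1}$, and every $f\in\mathscr{P}^m_d(H)$, one has $\mu(f(\mathrm{Crit}(f)\cap K))=0$, must satisfy $\beta_0(d,m)\ge(d-1)^{1/d}$.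
   Context: For a Hilbert space $H$ and $d,m\in\mathbb{N}$, $\mathscr{P}^m_d(H)$ is the set of maps $f:H\to\mathbb{R}^m$ that are $C^1$ in the Fréchet sense, whose differential $Df:H\to\mathcal{L}(H,\mathbb{R}^m)$ is weakly continuous and locally Lipschitz, and such that for every finite-dimensional linear subspace $E\subset H$ the restriction $f|_E$ is a polynomial map of degree at most $d$. $B_H(r)$ is the closed ball of radius $r$ centered at $0$. The Kolmogorov $n$-width is $\Omega_n(K,H)=\inf_{\dim E=n}\sup_{u\in K}\inf_{v\in E}\|u-v\|$ over $n$-dimensional linear subspaces $E$. $\mathrm{Crit}(f)=\{x:\operatorname{rank}D_xf\le m-1\}$; $\mu$ is Lebesgue measure on $\mathbb{R}^m$. *)

theory Defs
  imports "HOL-Analysis.Analysis"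
begin

definition Dfr :: "('a::real_normed_vector \<Rightarrow> 'b::real_normed_vector) \<Rightarrow> 'a \<Rightarrow> 'a \<Rightarrow>\<^sub>L 'b" where
  "Dfr f x = Blinfun (frechet_derivative f (at x))"

definition multi_idx :: "nat \<Rightarrow> nat \<Rightarrow> (nat \<Rightarrow> nat) set" where
  "multi_idx k d = {\<alpha>. (\<forall>i. k \<le> i \<longrightarrow> \<alpha> i = 0) \<and> (\<Sum>i<k. \<alpha> i) \<le> d}"

text \<open>f restricted to every finite-dimensional subspace E is a polynomial map of degree at
  most d: in the coordinates of any basis bs of E, f is a polynomial of degree at most d.\<close>
definition restr_poly :: "('a::real_vector \<Rightarrow> 'b::real_vector) \<Rightarrow> nat \<Rightarrow> bool" where
  "restr_poly f d \<longleftrightarrow>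
     (\<forall>bs::'a list. distinct bs \<and> independent (set bs) \<longrightarrow>
        (\<exists>c :: (nat \<Rightarrow> nat) \<Rightarrow> 'b. \<forall>t :: nat \<Rightarrow> real.
            f (\<Sum>i<length bs. t i *\<^sub>R bs ! i)
          = (\<Sum>\<alpha>\<in>multi_idx (length bs) d. (\<Prod>i<length bs. t i ^ \<alpha> i) *\<^sub>R c \<alpha>)))"

definition weak_conv :: "(nat \<Rightarrow> 'a::real_inner) \<Rightarrow> 'a \<Rightarrow> bool" where
  "weak_conv xs x \<longleftrightarrow> (\<forall>v. (\<lambda>n. xs n \<bullet> v) \<longlonglongrightarrow> x \<bullet> v)"

definition Pclass :: "nat \<Rightarrow> ('a::{real_inner,complete_space} \<Rightarrow> real ^ 'm) set" where
  "Pclass d = {f.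
      (\<forall>x. f differentiable (at x))
    \<and> continuous_on UNIV (Dfr f)
    \<and> (\<forall>xs x. weak_conv xs x \<longrightarrow> (\<lambda>n. Dfr f (xs n)) \<longlonglongrightarrow> Dfr f x)
    \<and> (\<forall>x. \<exists>r>0. \<exists>L. \<forall>y\<in>ball x r. \<forall>z\<in>ball x r. norm (Dfr f y - Dfr f z) \<le> L * dist y z)
    \<and> restr_poly f d}"

definition Crit :: "('a::real_normed_vector \<Rightarrow> real ^ 'm) \<Rightarrow> 'a set" where
  "Crit f = {x. dim (range (blinfun_apply (Dfr f x))) \<le> CARD('m) - 1}"

definition kwidth :: "nat \<Rightarrow> 'a::real_normed_vector set \<Rightarrow> real" where
  "kwidth n K = (if K = {} then 0 else
     (INF E\<in>{E. \<exists>B. independent B \<and> finite B \<and> card B = n \<and> span B = E}.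
        (SUP u\<in>K. infdist u E)))"

end

theory Submission
  imports Defs "HOL-Computational_Algebra.Polynomial" "HOL-Number_Theory.Cong"
    "HOL-Real_Asymp.Real_Asymp"
begin

text \<open>
  In coordinates of an orthonormal basis take the series of \<open>a\<^sub>k p(q\<^sup>k x\<^sub>k)\<close> over \<open>k\<close> as one component of
  the map, and \<open>m - 1\<close> further coordinates as the others. Here \<open>p\<close> is an integer polynomial of degree
  \<open>d\<close> with \<open>d - 1\<close> integer critical points and pairwise distinct critical values. Critical points are
  the sequences with every \<open>q\<^sup>k x\<^sub>k\<close> critical for \<open>p\<close>, so they form a box with sides of order \<open>q\<^sup>-\<^sup>k\<close>,
  and critical values are the sums of \<open>a\<^sub>k v\<^sub>k\<close> with free digits \<open>v\<^sub>k\<close> in the set \<open>V\<close> of critical values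
  of \<open>p\<close>.

  No regular spacing of \<open>V\<close> is needed, because the weights can be chosen instead. Fix \<open>\<eta> < d - 1\<close>. For
  \<open>P\<close> coprime to all differences in \<open>V\<close>, averaging over the next coefficient shows that a set of
  attained residues modulo \<open>P\<close> can be made to grow almost by the factor \<open>d - 1\<close> while it is sparse, and
  that the density of its complement can be squared once it is not. Hence for some \<open>l\<close> and \<open>P \<ge> \<eta> ^ l\<close>
  there are \<open>b\<^sub>0, \<dots>, b\<^sub>l\<^sub>-\<^sub>1\<close> such that the sums of \<open>b\<^sub>i v\<^sub>i\<close> attain every residue modulo \<open>P\<close>. Repeating
  this block with weights \<open>b\<^sub>i / P ^ (s + 1)\<close> gives \<open>a\<^sub>k = O(\<eta>\<^sup>-\<^sup>k)\<close> and digit sums whose integer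
  translates are dense; as the set of digit sums is compact, these translates cover the line and the
  set has positive measure. Taking \<open>q ^ d < \<eta>\<close> makes \<open>a\<^sub>k q\<^sup>k\<^sup>d\<close> summable, which gives the regularity of
  the map.
\<close>

section \<open>A polynomial with distinct critical values\<close>

text \<open>Termwise integration divides by \<open>Suc i\<close> for \<open>i \<le> n\<close>. All
  these numbers divide \<open>fact (Suc n)\<close>, so the factor \<open>L\<close> keeps the
  coefficients integral.\<close>

lemma int_poly_antiderivative:
  fixes p :: "int poly"
  obtains P L where "L \<noteq> 0" "pderiv P = smult L p"
proof -
  define n where "n = degree p"
  define L :: int where "L = fact (Suc n)"
  define P where "P = (\<Sum>i\<le>n. monom (coeff p i * (L div int (Suc i))) (Suc i))"
  have "pderiv P = (\<Sum>i\<le>n. monom (L * coeff p i) i)"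
    unfolding P_def higher_pderiv_sum[of 1, simplified]
  proof (rule sum.cong, rule refl)
    fix i assume "i \<in> {..n}"
    then have "int (Suc i) dvd L"
      using dvd_fact[of "Suc i" "Suc n"] int_dvd_int_iff[of "Suc i" "fact (Suc n)"]
      unfolding L_def of_nat_fact by simp
    then have "int (Suc i) * (L div int (Suc i)) = L" by simp
    then show "pderiv (monom (coeff p i * (L div int (Suc i))) (Suc i)) = monom (L * coeff p i) i"
      by (simp add: pderiv_monom mult.left_commute[of "1 + int i"])
  qed
  also have "\<dots> = smult L p"
    by (rule poly_eqI) (auto simp: coeff_sum n_def coeff_eq_0)
  finally show ?thesis
    by (intro that[of L P]) (auto simp: L_def)
qed

text \<open>Induction adding one critical point \<open>M\<close>: if \<open>P\<close> has derivative
  \<open>L p\<close>, then \<open>L p (x - M) - P\<close> has derivative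
  \<open>L p' (x - M)\<close>, and its critical values are distinct for all but finitely many
  integers \<open>M\<close>. Integral critical values are what allows residue arguments with them as
  digits.\<close>

lemma exists_poly_distinct_critical_values:
  "\<exists>(p::int poly) \<kappa> C. \<kappa> \<noteq> 0 \<and> finite C \<and> card C = n \<and> degree p = Suc n \<and>
      pderiv p = smult \<kappa> (\<Prod>c\<in>C. [:-c, 1:]) \<and> inj_on (poly p) C"
proof (induction n)
  case 0
  show ?case
    by (rule exI[of _ "[:0, 1:]"], rule exI[of _ 1], rule exI[of _ "{}"]) (simp add: pderiv_pCons)
next
  case (Suc n)
  then obtain p :: "int poly" and \<kappa> C where p: "\<kappa> \<noteq> 0" "finite C" "card C = n" "degree p = Suc n"
     "pderiv p = smult \<kappa> (\<Prod>c\<in>C. [:-c, 1:])" "inj_on (poly p) C" by blast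
  obtain P L where L: "L \<noteq> 0" and P: "pderiv P = smult L p"
    by (rule int_poly_antiderivative)
  have degP: "degree P = Suc (Suc n)"
  proof -
    have "degree P - 1 = Suc n"
      using degree_pderiv[of P] P L p(4) by simp
    then show ?thesis by simp
  qed
  text \<open>The new critical point \<open>M\<close> only has to avoid the roots of finitely many polynomials.\<close>
  define A where "A = (\<lambda>c c'. [: L * poly p c * c - poly P c - L * poly p c' * c' + poly P c',
                             - L * (poly p c - poly p c') :])"
  define B where "B = (\<lambda>c. P + [: L * poly p c * c - poly P c, - L * poly p c :])"
  define bad where "bad = C \<union> (\<Union>c\<in>C. \<Union>c'\<in>C - {c}. {M. poly (A c c') M = 0})
                            \<union> (\<Union>c\<in>C. {M. poly (B c) M = 0})"
  \<comment> \<open>In the variable \<open>M\<close>, \<open>A c c'\<close> is the difference of the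
    new values at \<open>c\<close> and \<open>c'\<close>. Its slope is nonzero because the old
    values differ.\<close>
  have A0: "A c c' \<noteq> 0" if "c \<in> C" "c' \<in> C - {c}" for c c'
    using that p(6) L by (auto simp: A_def inj_on_def)
  \<comment> \<open>\<open>B c\<close> compares the new values at \<open>c\<close> and at
    \<open>M\<close> itself. An affine function cannot cancel \<open>P\<close>, whose degree is at
    least 2.\<close>
  have B0: "B c \<noteq> 0" for c
  proof
    assume "B c = 0"
    then have "P = - [: L * poly p c * c - poly P c, - L * poly p c :]"
      unfolding B_def by (simp only: eq_neg_iff_add_eq_0)
    then have "degree P \<le> 1"
      using degree_pCons_le[of "poly P c - L * poly p c * c" "[:L * poly p c:]"] by simp
    then show False using degP by simp
  qed
  have "finite bad"
    unfolding bad_def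
    by (intro finite_UnI finite_UN_I finite_Diff p(2) poly_roots_finite A0 B0)
  then obtain M where M: "M \<notin> bad"
    using ex_new_if_finite[OF infinite_UNIV_int] by blast
  define p' where "p' = smult L (p * [:-M, 1:]) - P"
  have "pderiv p' = smult L (pderiv p * [:-M, 1:])"
    unfolding p'_def by (simp add: pderiv_diff pderiv_smult pderiv_mult P pderiv_pCons smult_add_right smult_diff_right)
  also have "\<dots> = smult (L * \<kappa>) (\<Prod>c\<in>insert M C. [:-c, 1:])"
    using M p(2) unfolding p(5) bad_def by (simp add: mult.commute)
  finally have d: "pderiv p' = smult (L * \<kappa>) (\<Prod>c\<in>insert M C. [:-c, 1:])" .
  have "degree (\<Prod>c\<in>insert M C. [:-c, 1:]) = Suc n"
    using M p(2,3) unfolding bad_def by (subst degree_prod_eq_sum_degree) auto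
  then have deg: "degree p' = Suc (Suc n)"
    using degree_pderiv[of p'] d L p(1) by simp
  have ev: "poly p' x = L * poly p x * (x - M) - poly P x" for x
    by (simp add: p'_def algebra_simps)
  have "poly p' c \<noteq> poly p' c'" if "c \<in> C" "c' \<in> C" "c \<noteq> c'" for c c'
  proof -
    have "poly (A c c') M \<noteq> 0" using M that unfolding bad_def by blast
    then show ?thesis unfolding A_def ev by (simp add: algebra_simps)
  qed
  moreover have "poly p' c \<noteq> poly p' M" if "c \<in> C" for c
  proof -
    have "poly (B c) M \<noteq> 0" using M that unfolding bad_def by blast
    then show ?thesis unfolding B_def ev by (simp add: algebra_simps)
  qed
  ultimately have "inj_on (poly p') (insert M C)"
    unfolding inj_on_def by (metis insert_iff)
  moreover have "card (insert M C) = Suc n" using M p(2,3) unfolding bad_def by simp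
  ultimately show ?case using d deg L p(1,2)
    by (intro exI[of _ p'] exI[of _ "L * \<kappa>"] exI[of _ "insert M C"]) auto
qed

section \<open>Covering all residues by digit sums\<close>

definition shift_mod :: "int \<Rightarrow> int set \<Rightarrow> int \<Rightarrow> int set" where
  "shift_mod P A t = (\<lambda>a. (a + t) mod P) ` A"

lemma shift_mod_subset: "P > 0 \<Longrightarrow> shift_mod P A t \<subseteq> {0..<P}"
  by (auto simp: shift_mod_def)

lemma add_mod_cancel_int:
  fixes P :: int
  assumes "a \<in> {0..<P}" "b \<in> {0..<P}" "(a + t) mod P = (b + t) mod P"
  shows "a = b"
proof -
  have "[a + t = b + t] (mod P)" using assms(3) by (simp add: cong_def)
  then have "[a = b] (mod P)" by (simp add: cong_add_rcancel)
  then show ?thesis using assms(1,2) by (simp add: cong_def)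
qed

lemma card_shift_mod:
  assumes "A \<subseteq> {0..<P}"
  shows "card (shift_mod P A t) = card A"
  unfolding shift_mod_def
  by (rule card_image, rule inj_onI) (use assms add_mod_cancel_int in blast)

lemma shift_mod_complement:
  assumes "P > 0"
  shows "{0..<P} - shift_mod P A t \<subseteq> shift_mod P ({0..<P} - A) t"
proof
  fix x assume x: "x \<in> {0..<P} - shift_mod P A t"
  define y where "y = (x - t) mod P"
  have xy: "x = (y + t) mod P" using x by (simp add: y_def mod_simps)
  have "y \<in> {0..<P}" using assms by (simp add: y_def)
  moreover have "y \<notin> A" using x xy by (auto simp: shift_mod_def)
  ultimately show "x \<in> shift_mod P ({0..<P} - A) t"
    using xy by (auto simp: shift_mod_def)
qed

text \<open>For fixed \<open>s\<close> and \<open>t\<close> there is exactly one \<open>b\<close> modulo \<open>P\<close> with \<open>s + b v = t + b w\<close>, so over a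
  uniformly random \<open>b\<close> the two shifted sets meet as if they were independent.\<close>
lemma sum_card_shift_mod_Int_le:
  fixes P :: int
  assumes P: "P > 0" and S: "finite S" and T: "finite T" and co: "coprime (v - w) P"
  shows "(\<Sum>b\<in>{1..P}. card (shift_mod P S (b * v) \<inter> shift_mod P T (b * w))) \<le> card S * card T"
proof -
  define E where "E = (\<lambda>b z. (fst z + b * v) mod P = (snd z + b * w) mod P)"
  \<comment> \<open>Double counting: a common point of the two shifts comes from some pair
    \<open>z\<close> with \<open>E b z\<close>, and after swapping the sums each pair is counted for
    at most one \<open>b\<close>.\<close>
  have "card (shift_mod P S (b * v) \<inter> shift_mod P T (b * w)) \<le> card {z \<in> S \<times> T. E b z}" for b
  proof (rule surj_card_le)
    show "finite {z \<in> S \<times> T. E b z}" using S T by auto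
    show "shift_mod P S (b * v) \<inter> shift_mod P T (b * w)
        \<subseteq> (\<lambda>z. (fst z + b * v) mod P) ` {z \<in> S \<times> T. E b z}"
      by (force simp: shift_mod_def E_def)
  qed
  then have "(\<Sum>b\<in>{1..P}. card (shift_mod P S (b * v) \<inter> shift_mod P T (b * w)))
     \<le> (\<Sum>b\<in>{1..P}. card {z \<in> S \<times> T. E b z})" by (rule sum_mono)
  also have "\<dots> = (\<Sum>b\<in>{1..P}. \<Sum>z\<in>S \<times> T. if E b z then 1 else 0)"
    using S T by (simp add: sum.If_cases Int_def)
  also have "\<dots> = (\<Sum>z\<in>S \<times> T. \<Sum>b\<in>{1..P}. if E b z then 1 else 0)"
    by (rule sum.swap)
  also have "\<dots> \<le> (\<Sum>z\<in>S \<times> T. 1)"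
  proof (rule sum_mono)
    fix z
    have "b = b'" if "b \<in> {1..P}" "b' \<in> {1..P}" "E b z" "E b' z" for b b'
    proof -
      have "[fst z + b * v = snd z + b * w] (mod P)" "[fst z + b' * v = snd z + b' * w] (mod P)"
        using that by (auto simp: E_def cong_def)
      then have "[(fst z + b * v) - (fst z + b' * v) = (snd z + b * w) - (snd z + b' * w)] (mod P)"
        by (rule cong_diff)
      then have "P dvd (b - b') * (v - w)"
        unfolding cong_iff_dvd_diff by (simp add: algebra_simps)
      then have "P dvd b - b'"
        using co by (simp add: coprime_dvd_mult_left_iff coprime_commute)
      moreover have "\<bar>b - b'\<bar> < P" using that by auto
      ultimately show "b = b'" using zdvd_not_zless[of "\<bar>b - b'\<bar>" P] by fastforce
    qed
    then have "card {b \<in> {1..P}. E b z} \<le> Suc 0"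
      by (subst card_le_Suc0_iff_eq) (auto intro: finite_subset[of _ "{1..P}"])
    then show "(\<Sum>b\<in>{1..P}. if E b z then 1 else 0) \<le> (1::nat)"
      by (simp add: sum.If_cases Int_def)
  qed
  also have "\<dots> = card S * card T" by (simp add: card_cartesian_product)
  finally show ?thesis .
qed

text \<open>Bonferroni bound: a union is at least the sum of the sizes minus the pairwise overlaps,
  and each overlap contributes at most \<open>card A * card A\<close> in total over
  \<open>b\<close>. The induction adds one shift at a time.\<close>

lemma sum_card_UN_shift_mod_ge:
  fixes P :: int
  assumes P: "P > 0" and A: "A \<subseteq> {0..<P}" and V: "finite V"
    and co: "\<And>v w. v \<in> V \<Longrightarrow> w \<in> V \<Longrightarrow> v \<noteq> w \<Longrightarrow> coprime (v - w) P"
  shows "real (card V) * P * card A - (real (card V))\<^sup>2 * (real (card A))\<^sup>2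
    \<le> (\<Sum>b\<in>{1..P}. real (card (\<Union>v\<in>V. shift_mod P A (b * v))))"
  using V co
proof (induction V rule: finite_induct)
  case empty
  then show ?case by simp
next
  case (insert w V)
  have fA: "finite A" using A finite_subset by blast
  define X where "X = (\<lambda>b. \<Union>v\<in>V. shift_mod P A (b * v))"
  define Y where "Y = (\<lambda>b. shift_mod P A (b * w))"
  have fX: "finite (X b)" and fY: "finite (Y b)" for b
    using insert(1) fA by (auto simp: X_def Y_def shift_mod_def)
  have step: "real (card (Y b \<union> X b)) \<ge> card A + real (card (X b))
      - (\<Sum>v\<in>V. real (card (shift_mod P A (b * v) \<inter> Y b)))" for b
  proof -
    have "card (Y b) + card (X b) = card (Y b \<union> X b) + card (Y b \<inter> X b)"
      by (rule card_Un_Int[OF fY fX])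
    moreover have "card (Y b \<inter> X b) \<le> (\<Sum>v\<in>V. card (shift_mod P A (b * v) \<inter> Y b))"
    proof -
      have "Y b \<inter> X b = (\<Union>v\<in>V. shift_mod P A (b * v) \<inter> Y b)" by (auto simp: X_def)
      then show ?thesis using card_UN_le[OF insert(1)] by metis
    qed
    moreover have "card (Y b) = card A" unfolding Y_def by (rule card_shift_mod[OF A])
    ultimately show ?thesis by (simp flip: of_nat_sum of_nat_add)
  qed
  have "(\<Sum>b\<in>{1..P}. \<Sum>v\<in>V. real (card (shift_mod P A (b * v) \<inter> Y b)))
      = (\<Sum>v\<in>V. real (\<Sum>b\<in>{1..P}. card (shift_mod P A (b * v) \<inter> Y b)))"
    by (subst sum.swap) simp
  also have "\<dots> \<le> (\<Sum>v\<in>V. real (card A * card A))"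
  proof (intro sum_mono, unfold of_nat_le_iff Y_def)
    fix v assume v: "v \<in> V"
    have "v \<noteq> w" using v insert(2) by auto
    then have "coprime (v - w) P" using v by (intro insert(4)) auto
    then show "(\<Sum>b\<in>{1..P}. card (shift_mod P A (b * v) \<inter> shift_mod P A (b * w))) \<le> card A * card A"
      by (rule sum_card_shift_mod_Int_le[OF P fA fA])
  qed
  finally have sw: "(\<Sum>b\<in>{1..P}. \<Sum>v\<in>V. real (card (shift_mod P A (b * v) \<inter> Y b)))
       \<le> real (card V) * (real (card A))\<^sup>2" by (simp add: power2_eq_square)
  have IH: "real (card V) * P * card A - (real (card V))\<^sup>2 * (real (card A))\<^sup>2
    \<le> (\<Sum>b\<in>{1..P}. real (card (X b)))"
    unfolding X_def using insert(3,4) by blast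
  \<comment> \<open>The overlaps with the new shift fit into the quadratic allowance, since
    \<open>n\<^sup>2 + n \<le> (n + 1)\<^sup>2\<close>.\<close>
  have "real (card (insert w V)) * P * card A - (real (card (insert w V)))\<^sup>2 * (real (card A))\<^sup>2
      \<le> P * real (card A) + (real (card V) * P * card A - (real (card V))\<^sup>2 * (real (card A))\<^sup>2)
       - real (card V) * (real (card A))\<^sup>2"
    using insert(1,2) by (simp add: algebra_simps power2_eq_square)
  also have "\<dots> \<le> (\<Sum>b\<in>{1..P}. card A + real (card (X b))
      - (\<Sum>v\<in>V. real (card (shift_mod P A (b * v) \<inter> Y b))))"
    using IH sw P by (simp add: sum.distrib sum_subtractf)
  also have "\<dots> \<le> (\<Sum>b\<in>{1..P}. real (card (Y b \<union> X b)))"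
    by (rule sum_mono[OF step])
  finally show ?case by (simp add: X_def Y_def)
qed

text \<open>Some \<open>b\<close> is at least as good as the average over \<open>{1..P}\<close>. The
  growth is nearly by the factor \<open>card V\<close> while \<open>card A\<close> is small against
  \<open>P\<close>.\<close>

lemma exists_shift_growth:
  fixes P :: int
  assumes P: "P > 0" and A: "A \<subseteq> {0..<P}" and V: "finite V"
    and co: "\<And>v w. v \<in> V \<Longrightarrow> w \<in> V \<Longrightarrow> v \<noteq> w \<Longrightarrow> coprime (v - w) P"
  shows "\<exists>b\<ge>1. real (card (\<Union>v\<in>V. shift_mod P A (b * v)))
    \<ge> real (card V) * card A - (real (card V))\<^sup>2 * (real (card A))\<^sup>2 / P"
proof (rule ccontr)
  assume not: "\<not> ?thesis"
  have "(\<Sum>b\<in>{1..P}. real (card (\<Union>v\<in>V. shift_mod P A (b * v))))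
     < (\<Sum>b\<in>{1..P}. real (card V) * card A - (real (card V))\<^sup>2 * (real (card A))\<^sup>2 / P)"
    using P not by (intro sum_strict_mono) (simp, simp, meson atLeastAtMost_iff not_le)
  also have "\<dots> = real (card V) * P * card A - (real (card V))\<^sup>2 * (real (card A))\<^sup>2"
    using P by (simp add: field_simps)
  finally show False using sum_card_UN_shift_mod_ge[OF P A V co] by simp
qed

text \<open>A residue missed by the union lies in the translates of the complement of
  \<open>A\<close> by both \<open>b * v\<close> and \<open>b * w\<close>. On average over
  \<open>b\<close> these two meet as independent sets would, so two digits suffice to square the
  density of the complement.\<close>

lemma exists_shift_complement:
  fixes P :: int
  assumes P: "P > 0" and v: "v \<in> V" "w \<in> V" and co: "coprime (v - w) P"
  shows "\<exists>b\<ge>1. real (card ({0..<P} - (\<Union>v\<in>V. shift_mod P A (b * v))))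
    \<le> (real (card ({0..<P} - A)))\<^sup>2 / P"
proof (rule ccontr)
  assume not: "\<not> ?thesis"
  define U where "U = {0..<P} - A"
  have fU: "finite U" by (simp add: U_def)
  have "(\<Sum>b\<in>{1..P}. (real (card U))\<^sup>2 / P)
     < (\<Sum>b\<in>{1..P}. real (card ({0..<P} - (\<Union>v\<in>V. shift_mod P A (b * v)))))"
    using P not unfolding U_def by (intro sum_strict_mono) (simp, simp, meson atLeastAtMost_iff not_le)
  also have "\<dots> \<le> (\<Sum>b\<in>{1..P}. real (card (shift_mod P U (b * v) \<inter> shift_mod P U (b * w))))"
  proof (rule sum_mono, unfold of_nat_le_iff, rule card_mono)
    fix b
    show "finite (shift_mod P U (b * v) \<inter> shift_mod P U (b * w))"
      using fU by (simp add: shift_mod_def)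
    show "{0..<P} - (\<Union>v\<in>V. shift_mod P A (b * v)) \<subseteq> shift_mod P U (b * v) \<inter> shift_mod P U (b * w)"
      using v shift_mod_complement[OF P, of A] unfolding U_def by blast
  qed
  also have "\<dots> = real (\<Sum>b\<in>{1..P}. card (shift_mod P U (b * v) \<inter> shift_mod P U (b * w)))"
    by simp
  also have "\<dots> \<le> real (card U * card U)"
    using sum_card_shift_mod_Int_le[OF P fU fU co] by (simp only: of_nat_le_iff)
  finally show False using P by (simp add: power2_eq_square)
qed

text \<open>The digits form a total function, so appending a digit is a function update; only the
  first \<open>n\<close> values enter the sum.\<close>

definition digit_sums :: "int \<Rightarrow> int set \<Rightarrow> nat \<Rightarrow> (nat \<Rightarrow> int) \<Rightarrow> int set" where
  "digit_sums P V n b = {(\<Sum>i<n. b i * w i) mod P | w. \<forall>i. w i \<in> V}"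

lemma digit_sums_subset: "P > 0 \<Longrightarrow> digit_sums P V n b \<subseteq> {0..<P}"
  by (auto simp: digit_sums_def)

lemma digit_sums_Suc:
  "(\<Union>v\<in>V. shift_mod P (digit_sums P V n b) (\<beta> * v)) \<subseteq> digit_sums P V (Suc n) (b(n := \<beta>))"
proof
  fix x assume "x \<in> (\<Union>v\<in>V. shift_mod P (digit_sums P V n b) (\<beta> * v))"
  then obtain v w where v: "v \<in> V" and w: "\<forall>i. w i \<in> V"
    and x: "x = ((\<Sum>i<n. b i * w i) mod P + \<beta> * v) mod P"
    by (auto simp: shift_mod_def digit_sums_def)
  have "(\<Sum>i<Suc n. (b(n := \<beta>)) i * (w(n := v)) i) = (\<Sum>i<n. b i * w i) + \<beta> * v"
    by simp
  then have "x = (\<Sum>i<Suc n. (b(n := \<beta>)) i * (w(n := v)) i) mod P"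
    unfolding x by (simp add: mod_simps)
  moreover have "\<forall>i. (w(n := v)) i \<in> V" using v w by simp
  ultimately show "x \<in> digit_sums P V (Suc n) (b(n := \<beta>))"
    unfolding digit_sums_def by blast
qed

text \<open>Greedy choice of coefficients. Below density \<open>\<delta>\<close> the overlap loss is
  at most \<open>(card V)\<^sup>2 * \<delta> * card A\<close>, which leaves a growth factor of at
  least \<open>\<eta>\<close>; from density \<open>\<delta>\<close> on it is enough not to
  shrink.\<close>

lemma digit_sums_growth:
  fixes P :: int and \<eta> \<delta> :: real
  assumes P: "P > 0" and V: "finite V" "V \<noteq> {}"
    and co: "\<And>v w. v \<in> V \<Longrightarrow> w \<in> V \<Longrightarrow> v \<noteq> w \<Longrightarrow> coprime (v - w) P"
    and \<eta>: "\<eta> \<ge> 0" "\<eta> \<le> card V - (card V)\<^sup>2 * \<delta>"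
  shows "\<exists>b. (\<forall>i. b i \<ge> 1) \<and> real (card (digit_sums P V n b)) \<ge> min (\<eta> ^ n) (\<delta> * P)"
proof (induction n)
  case 0
  have "digit_sums P V 0 b = {0}" for b using V by (auto simp: digit_sums_def)
  then show ?case by (intro exI[of _ "\<lambda>_. 1"]) simp
next
  case (Suc n)
  then obtain b where b: "\<forall>i. b i \<ge> 1" "real (card (digit_sums P V n b)) \<ge> min (\<eta> ^ n) (\<delta> * P)"
    by blast
  define A where "A = digit_sums P V n b"
  have A: "A \<subseteq> {0..<P}" unfolding A_def by (rule digit_sums_subset[OF P])
  have le: "real (card (\<Union>v\<in>V. shift_mod P A (\<beta> * v))) \<le> card (digit_sums P V (Suc n) (b(n := \<beta>)))" for \<beta>
    unfolding A_def of_nat_le_iff using digit_sums_subset[OF P] digit_sums_Suc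
    by (intro card_mono) (auto intro: finite_subset[OF digit_sums_subset[OF P]])
  show ?case
  proof (cases "real (card A) \<ge> \<delta> * P")
    case True
    \<comment> \<open>The density is already reached. A single translate has the same cardinality,
      so any coefficient works, for instance 1.\<close>
    obtain v where v: "v \<in> V" using V by blast
    have "card A = card (shift_mod P A (1 * v))" by (rule card_shift_mod[OF A, symmetric])
    also have "\<dots> \<le> card (\<Union>v\<in>V. shift_mod P A (1 * v))"
      using v V shift_mod_subset[OF P] by (intro card_mono) (auto intro: finite_subset[OF shift_mod_subset[OF P]])
    finally have "\<delta> * P \<le> card (digit_sums P V (Suc n) (b(n := 1)))"
      using le[of 1] True by linarith
    then show ?thesis using b(1) by (intro exI[of _ "b(n := 1)"] conjI) (simp, simp del: fun_upd_apply)
  next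
    case False
    then have small: "real (card A) \<le> \<delta> * P" and big: "real (card A) \<ge> \<eta> ^ n"
      using b(2) unfolding A_def by auto
    obtain \<beta> where \<beta>: "\<beta> \<ge> 1" "real (card (\<Union>v\<in>V. shift_mod P A (\<beta> * v)))
        \<ge> real (card V) * card A - (real (card V))\<^sup>2 * (real (card A))\<^sup>2 / P"
      using exists_shift_growth[OF P A V(1) co] by blast
    have "\<eta> ^ Suc n \<le> \<eta> * card A" using big \<eta>(1) by (simp add: mult_left_mono)
    also have "\<dots> \<le> (card V - (card V)\<^sup>2 * \<delta>) * card A"
      using \<eta>(2) by (intro mult_right_mono) auto
    also have "\<dots> = real (card V) * card A - (real (card V))\<^sup>2 * (real (card A)) * \<delta>"
      by (simp add: algebra_simps)
    also have "\<dots> \<le> real (card V) * card A - (real (card V))\<^sup>2 * (real (card A)) * (card A / P)"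
      using small P by (intro diff_left_mono mult_left_mono) (auto simp: field_simps)
    also have "\<dots> = real (card V) * card A - (real (card V))\<^sup>2 * (real (card A))\<^sup>2 / P"
      by (simp add: power2_eq_square)
    also have "\<dots> \<le> card (digit_sums P V (Suc n) (b(n := \<beta>)))"
      using \<beta>(2) le[of \<beta>] by linarith
    finally show ?thesis using b(1) \<beta>(1) by (intro exI[of _ "b(n := \<beta>)"] conjI) (simp, simp del: fun_upd_apply)
  qed
qed

text \<open>Each further digit squares the density of the missed residues, so \<open>s\<close>
  digits turn \<open>1 - \<delta>\<close> into its power with exponent \<open>2 ^ s\<close>.\<close>

lemma digit_sums_complement:
  fixes P :: int and \<delta> :: real
  assumes P: "P > 0" and v: "v \<in> V" "w \<in> V" and co: "coprime (v - w) P"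
    and b: "\<forall>i. b i \<ge> 1" and \<delta>: "real (card (digit_sums P V n b)) \<ge> \<delta> * P"
  shows "\<exists>b'. (\<forall>i. b' i \<ge> 1) \<and>
     real (card ({0..<P} - digit_sums P V (n + s) b')) \<le> (1 - \<delta>) ^ (2 ^ s) * P"
proof (induction s)
  case 0
  have "card ({0..<P} - digit_sums P V n b) = nat P - card (digit_sums P V n b)"
    using digit_sums_subset[OF P, of V n b] finite_subset by (subst card_Diff_subset) auto
  moreover have "card (digit_sums P V n b) \<le> nat P"
    using card_mono[OF _ digit_sums_subset[OF P, of V n b]] by simp
  ultimately have "real (card ({0..<P} - digit_sums P V n b)) \<le> (1 - \<delta>) * P"
    using P \<delta> by (simp add: of_nat_diff algebra_simps)
  then show ?case using b by (intro exI[of _ b]) simp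
next
  case (Suc s)
  then obtain b' where b': "\<forall>i. b' i \<ge> 1"
     "real (card ({0..<P} - digit_sums P V (n + s) b')) \<le> (1 - \<delta>) ^ (2 ^ s) * P" by blast
  define A where "A = digit_sums P V (n + s) b'"
  obtain \<beta> where \<beta>: "\<beta> \<ge> 1" "real (card ({0..<P} - (\<Union>v\<in>V. shift_mod P A (\<beta> * v))))
    \<le> (real (card ({0..<P} - A)))\<^sup>2 / P"
    using exists_shift_complement[OF P v co] by blast
  have "real (card ({0..<P} - digit_sums P V (Suc (n + s)) (b'(n + s := \<beta>))))
      \<le> real (card ({0..<P} - (\<Union>v\<in>V. shift_mod P A (\<beta> * v))))"
    unfolding of_nat_le_iff A_def using digit_sums_Suc
    by (intro card_mono Diff_mono order_refl) auto
  also have "\<dots> \<le> (real (card ({0..<P} - A)))\<^sup>2 / P" by (rule \<beta>(2))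
  also have "\<dots> \<le> ((1 - \<delta>) ^ (2 ^ s) * P)\<^sup>2 / P"
    using b'(2) P unfolding A_def by (intro divide_right_mono power_mono) auto
  also have "\<dots> = (1 - \<delta>) ^ (2 ^ Suc s) * P"
    using P by (simp add: power2_eq_square power_mult mult.commute[of 2] power_mult_distrib)
  finally show ?case using b'(1) \<beta>(1) by (intro exI[of _ "b'(n + s := \<beta>)"] conjI) (simp, simp del: fun_upd_apply)
qed

text \<open>Two phases: \<open>J * s\<close> digits bring the density up to \<open>\<delta>\<close>,
  then \<open>s\<close> more digits remove the rest. The modulus must lie between
  \<open>\<eta> ^ (J * s + s)\<close>, as the claim demands, and \<open>\<eta>' ^ (J * s)\<close>,
  so that the first phase reaches density \<open>\<delta>\<close>.\<close>

lemma exists_residue_cover: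
  fixes V :: "int set" and \<eta> :: real
  assumes V: "finite V" "card V \<ge> 2" and \<eta>: "1 < \<eta>" "\<eta> < card V"
  shows "\<exists>l P b. l > 0 \<and> P > 1 \<and> \<eta> ^ l \<le> real_of_int P \<and> (\<forall>i. b i \<ge> 1) \<and>
     (\<forall>r. \<exists>w. (\<forall>i. w i \<in> V) \<and> [(\<Sum>i<l. b i * w i) = r] (mod P))"
proof -
  define D where "D = real (card V)"
  define \<eta>' where "\<eta>' = (\<eta> + D) / 2"
  have \<eta>': "\<eta> < \<eta>'" "\<eta>' < D" using \<eta> by (auto simp: \<eta>'_def D_def)
  \<comment> \<open>Chosen so that the guaranteed growth factor
    \<open>D - D\<^sup>2 * \<delta>\<close> is exactly \<open>\<eta>'\<close>.\<close>
  define \<delta> where "\<delta> = (D - \<eta>') / D\<^sup>2"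
  have D2: "D \<ge> 2" using V by (simp add: D_def)
  have \<delta>: "\<delta> > 0" "D - D\<^sup>2 * \<delta> = \<eta>'" using \<eta>' D2 by (auto simp: \<delta>_def)
  have "\<delta> < 1"
  proof -
    have "D - \<eta>' < D" using \<eta> \<eta>' by simp
    also have "D \<le> D\<^sup>2" using D2 by (simp add: power2_eq_square)
    finally show ?thesis using D2 by (simp add: \<delta>_def)
  qed
  \<comment> \<open>The surplus of \<open>\<eta>'\<close> over \<open>\<eta>\<close> in
    \<open>J\<close> growth steps pays for one extra digit of the second phase.\<close>
  obtain J :: nat where J: "\<eta> ^ Suc J < \<eta>' ^ J"
  proof -
    have "\<eta>' / \<eta> > 1" using \<eta> \<eta>' by simp
    then obtain J where "\<eta> < (\<eta>' / \<eta>) ^ J" using real_arch_pow by blast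
    then show ?thesis using \<eta> by (intro that[of J]) (simp add: field_simps)
  qed
  \<comment> \<open>Every difference of distinct digits divides \<open>\<Delta>\<close>, so a
    modulus congruent to 1 modulo \<open>\<Delta>\<close> is coprime to all of them.\<close>
  define \<Delta> where "\<Delta> = (\<Prod>v\<in>V. \<Prod>w\<in>V - {v}. \<bar>v - w\<bar>)"
  have \<Delta>: "\<Delta> > 0" unfolding \<Delta>_def by (intro prod_pos) auto
  define x where "x = \<eta> ^ Suc J"
  define y where "y = \<eta>' ^ J"
  have xy: "1 < x" "x < y" using J \<eta> by (auto simp: x_def y_def one_less_power simp del: power_Suc)
  \<comment> \<open>The factor \<open>2 * \<Delta> + 1\<close> absorbs the rounding: \<open>\<Delta>
    * \<lceil>x ^ s\<rceil> + 1 \<le> (2 * \<Delta> + 1) * x ^ s\<close>, as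
    \<open>x ^ s \<ge> 1\<close>.\<close>
  have "((\<lambda>s. (2 * real_of_int \<Delta> + 1) * (x / y) ^ s) \<longlongrightarrow> (2 * real_of_int \<Delta> + 1) * 0) sequentially"
    using xy by (intro tendsto_intros LIMSEQ_power_zero) auto
  then have ev1: "\<forall>\<^sub>F s in sequentially. (2 * real_of_int \<Delta> + 1) * (x / y) ^ s < 1"
    by (intro order_tendstoD) auto
  \<comment> \<open>Doubly exponential decay beats the exponential bound \<open>y ^ s\<close> on the
    modulus.\<close>
  have "((\<lambda>s::nat. (1 - \<delta>) ^ (2 ^ s) * y ^ s) \<longlongrightarrow> 0) sequentially"
  proof -
    define L where "L = - ln (1 - \<delta>)"
    have L: "L > 0" using \<delta>(1) \<open>\<delta> < 1\<close> by (simp add: L_def)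
    have "((\<lambda>s::nat. exp (- (2 ^ s * L) + s * ln y)) \<longlongrightarrow> 0) sequentially"
      using L xy by real_asymp
    moreover have "exp (- (2 ^ s * L) + s * ln y) = (1 - \<delta>) ^ (2 ^ s) * y ^ s" for s :: nat
    proof -
      have "exp (2 ^ s * ln (1 - \<delta>)) = (1 - \<delta>) ^ (2 ^ s)"
        using exp_of_nat_mult[of "2 ^ s" "ln (1 - \<delta>)"] \<open>\<delta> < 1\<close> by simp
      moreover have "exp (s * ln y) = y ^ s"
        using exp_of_nat_mult[of s "ln y"] xy by simp
      ultimately show ?thesis by (simp add: exp_add L_def)
    qed
    ultimately show ?thesis by simp
  qed
  then have ev2: "\<forall>\<^sub>F s in sequentially. (1 - \<delta>) ^ (2 ^ s) * y ^ s < 1"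
    by (intro order_tendstoD) auto
  obtain s where s: "s > 0" "(2 * real_of_int \<Delta> + 1) * (x / y) ^ s < 1" "(1 - \<delta>) ^ (2 ^ s) * y ^ s < 1"
    using eventually_happens'[OF _ eventually_conj[OF ev1 eventually_conj[OF ev2 eventually_gt_at_top[of 0]]]]
    by auto
  define P where "P = \<Delta> * \<lceil>x ^ s\<rceil> + 1"
  have xs: "1 \<le> x ^ s" using xy by simp
  have Px: "x ^ s \<le> P"
  proof -
    have "x ^ s \<le> \<lceil>x ^ s\<rceil>" by simp
    also have "\<dots> \<le> \<Delta> * \<lceil>x ^ s\<rceil>" using \<Delta> xs by (subst of_int_le_iff) (simp add: mult_le_cancel_right1)
    finally show ?thesis by (simp add: P_def)
  qed
  have Py: "P \<le> y ^ s"
  proof -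
    have "real_of_int P = real_of_int \<Delta> * real_of_int \<lceil>x ^ s\<rceil> + 1" by (simp add: P_def)
    also have "\<dots> \<le> \<Delta> * (2 * x ^ s) + x ^ s"
      using \<Delta> xs by (intro add_mono mult_left_mono) linarith+
    also have "\<dots> = (2 * real_of_int \<Delta> + 1) * (x / y) ^ s * y ^ s"
      using xy by (simp add: algebra_simps power_divide)
    also have "\<dots> \<le> 1 * y ^ s" using s(2) xy by (intro mult_right_mono) auto
    finally show ?thesis by simp
  qed
  have P1: "P > 1"
  proof -
    have "\<lceil>x ^ s\<rceil> > 0" using xs by linarith
    then show ?thesis using \<Delta> by (simp add: P_def)
  qed
  have P: "P > 0" using P1 by simp
  have co: "coprime (v - w) P" if "v \<in> V" "w \<in> V" "v \<noteq> w" for v w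
  proof -
    have "\<bar>v - w\<bar> dvd (\<Prod>w\<in>V - {v}. \<bar>v - w\<bar>)" using that V by (intro dvd_prodI) auto
    also have "\<dots> dvd \<Delta>" unfolding \<Delta>_def using that V by (intro dvd_prodI) auto
    finally have "v - w dvd \<Delta>" by simp
    then have d: "v - w dvd P - 1" by (simp add: P_def)
    show ?thesis
    proof (rule coprimeI)
      fix c assume "c dvd v - w" "c dvd P"
      then have "c dvd P - (P - 1)" using d dvd_trans dvd_diff by blast
      then show "is_unit c" by simp
    qed
  qed
  have ne: "V \<noteq> {}" using V by auto
  have le: "\<eta>' \<le> card V - (card V)\<^sup>2 * \<delta>" using \<delta>(2) by (simp add: D_def)
  have \<eta>'0: "0 \<le> \<eta>'" using \<eta> \<eta>' by simp
  obtain b where b: "\<forall>i. b i \<ge> 1"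
      "real (card (digit_sums P V (J * s) b)) \<ge> min (\<eta>' ^ (J * s)) (\<delta> * P)"
    using digit_sums_growth[OF P V(1) ne co \<eta>'0 le] by blast
  have "\<delta> * P \<le> 1 * real_of_int P" using \<open>\<delta> < 1\<close> P by (intro mult_right_mono) auto
  also have "\<dots> \<le> \<eta>' ^ (J * s)" using Py by (simp add: y_def power_mult)
  finally have bb: "real (card (digit_sums P V (J * s) b)) \<ge> \<delta> * P" using b(2) by simp
  obtain v w where vw: "v \<in> V" "w \<in> V" "v \<noteq> w"
    using V card_le_Suc0_iff_eq[of V] by fastforce
  obtain b' where b': "\<forall>i. b' i \<ge> 1"
     "real (card ({0..<P} - digit_sums P V (J * s + s) b')) \<le> (1 - \<delta>) ^ (2 ^ s) * P"
    using digit_sums_complement[OF P vw(1,2) co[OF vw] b(1) bb] by blast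
  have "(1 - \<delta>) ^ (2 ^ s) * P \<le> (1 - \<delta>) ^ (2 ^ s) * y ^ s"
    using Py \<open>\<delta> < 1\<close> by (intro mult_left_mono) auto
  \<comment> \<open>Fewer than one residue is missed, hence none.\<close>
  then have "card ({0..<P} - digit_sums P V (J * s + s) b') = 0"
    using b'(2) s(3) by linarith
  then have full: "{0..<P} \<subseteq> digit_sums P V (J * s + s) b'" by simp
  have "\<exists>w. (\<forall>i. w i \<in> V) \<and> [(\<Sum>i<J * s + s. b' i * w i) = r] (mod P)" for r
  proof -
    have "r mod P \<in> digit_sums P V (J * s + s) b'" using full P by auto
    then show ?thesis by (auto simp: digit_sums_def cong_def)
  qed
  moreover have "\<eta> ^ (J * s + s) \<le> P"
    using Px by (simp add: x_def power_mult[symmetric] algebra_simps flip: power_Suc)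
  ultimately show ?thesis using s(1) P1 b'(1)
    by (intro exI[of _ "J * s + s"] exI[of _ P] exI[of _ b'] conjI) auto
qed

section \<open>From residues to real numbers modulo 1\<close>

text \<open>With \<open>k = s l + i\<close> the weight is \<open>b i / P ^ (s + 1)\<close>: choosing the digit blocks from the last one
  backwards, the first \<open>n\<close> blocks represent every residue modulo \<open>P ^ n\<close>.\<close>
lemma block_expansion:
  fixes P :: int
  assumes l: "l > 0" and cov: "\<And>r. \<exists>w. (\<forall>i. w i \<in> V) \<and> [(\<Sum>i<l. b i * w i) = r] (mod P)"
  shows "\<exists>w z. (\<forall>i. w i \<in> V) \<and>
     (\<Sum>k<n * l. P ^ (n - Suc (k div l)) * b (k mod l) * w k) = N + z * P ^ n"
proof (induction n arbitrary: N)
  case 0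
  obtain w :: "nat \<Rightarrow> int" where "\<forall>i. w i \<in> V" using cov by blast
  then show ?case by (intro exI[of _ w] exI[of _ "-N"]) auto
next
  case (Suc n)
  \<comment> \<open>The last block has weight 1 and fixes \<open>N\<close> modulo \<open>P\<close>.
    The weights of the earlier blocks carry a factor \<open>P\<close>, and these blocks expand the
    quotient \<open>M\<close> by the induction hypothesis.\<close>
  obtain u where u: "\<forall>i. u i \<in> V" "[(\<Sum>i<l. b i * u i) = N] (mod P)" using cov by blast
  obtain M where M: "N = (\<Sum>i<l. b i * u i) + P * M"
    using u(2) by (metis cong_iff_lin cong_sym)
  obtain w z where w: "\<forall>i. w i \<in> V"
     "(\<Sum>k<n * l. P ^ (n - Suc (k div l)) * b (k mod l) * w k) = M + z * P ^ n"
    using Suc by blast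
  define w' where "w' = (\<lambda>k. if k < n * l then w k else u (k - n * l))"
  have "(\<Sum>k<Suc n * l. P ^ (Suc n - Suc (k div l)) * b (k mod l) * w' k)
     = (\<Sum>k<n * l. P ^ (Suc n - Suc (k div l)) * b (k mod l) * w' k)
      + (\<Sum>k=n * l..<n * l + l. P ^ (Suc n - Suc (k div l)) * b (k mod l) * w' k)"
    using sum.atLeastLessThan_concat[of 0 "n * l" "n * l + l"
        "\<lambda>k. P ^ (Suc n - Suc (k div l)) * b (k mod l) * w' k"]
    by (simp add: lessThan_atLeast0 add.commute)
  also have "(\<Sum>k<n * l. P ^ (Suc n - Suc (k div l)) * b (k mod l) * w' k)
      = (\<Sum>k<n * l. P * (P ^ (n - Suc (k div l)) * b (k mod l) * w k))"
  proof (rule sum.cong)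
    fix k assume "k \<in> {..<n * l}"
    then have "k div l < n" "w' k = w k" by (auto simp: less_mult_imp_div_less w'_def)
    moreover from this have "n - k div l = Suc (n - Suc (k div l))" by simp
    ultimately show "P ^ (Suc n - Suc (k div l)) * b (k mod l) * w' k
        = P * (P ^ (n - Suc (k div l)) * b (k mod l) * w k)" by simp
  qed simp
  also have "\<dots> = P * (M + z * P ^ n)" unfolding sum_distrib_left[symmetric] w(2) ..
  also have "(\<Sum>k=n * l..<n * l + l. P ^ (Suc n - Suc (k div l)) * b (k mod l) * w' k)
      = (\<Sum>i<l. b i * u i)"
  proof (rule sum.reindex_bij_witness[of _ "\<lambda>i. i + n * l" "\<lambda>k. k - n * l"])
    fix k assume k: "k \<in> {n * l..<n * l + l}"
    then obtain i where i: "k = n * l + i" "i < l"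
      by (metis add_less_cancel_left atLeastLessThan_iff le_Suc_ex)
    then show "b (k - n * l) * u (k - n * l) = P ^ (Suc n - Suc (k div l)) * b (k mod l) * w' k"
      using l by (simp add: w'_def)
  qed auto
  finally have "(\<Sum>k<Suc n * l. P ^ (Suc n - Suc (k div l)) * b (k mod l) * w' k)
      = N + z * P ^ Suc n" by (simp add: M algebra_simps)
  moreover have "\<forall>i. w' i \<in> V" using w(1) u(1) by (simp add: w'_def)
  ultimately show ?case by blast
qed

text \<open>Division of the block expansion by \<open>P ^ n\<close> shows that finite digit sums
  reach every multiple of \<open>1 / P ^ n\<close> up to an integer; the tail of the series is small
  because \<open>a\<close> is summable. The decay of \<open>a\<close> comes from
  \<open>\<eta> ^ l \<le> P\<close>.\<close>

lemma exists_expansion_weights: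
  fixes V :: "int set" and \<eta> :: real
  assumes V: "finite V" "card V \<ge> 2" and \<eta>: "1 < \<eta>" "\<eta> < card V"
  obtains a :: "nat \<Rightarrow> real" and c where "\<And>k. 0 < a k" "\<And>k. a k \<le> c * (1 / \<eta>) ^ k"
    "\<And>x \<epsilon>. \<epsilon> > 0 \<Longrightarrow> \<exists>w (z::int). (\<forall>k. w k \<in> V) \<and> \<bar>(\<Sum>k. a k * real_of_int (w k)) - (x + z)\<bar> < \<epsilon>"
proof -
  obtain l P b where l: "l > 0" and P: "P > 1" "\<eta> ^ l \<le> real_of_int P" and b: "\<forall>i. b i \<ge> 1"
     and cov: "\<And>r. \<exists>w. (\<forall>i. w i \<in> V) \<and> [(\<Sum>i<l. b i * w i) = r] (mod P)"
    using exists_residue_cover[OF assms] by blast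
  define a where "a = (\<lambda>k. real_of_int (b (k mod l)) / P ^ Suc (k div l))"
  define \<beta> where "\<beta> = real_of_int (Max (b ` {..<l}))"
  have b\<beta>: "b (k mod l) \<le> \<beta>" for k
    unfolding \<beta>_def of_int_le_iff using l by (intro Max_ge) auto
  have b0: "0 < b i" for i using b by (meson int_one_le_iff_zero_less)
  have \<beta>: "\<beta> \<ge> 0" using b\<beta>[of 0] b0[of "0 mod l"] by linarith
  have a0: "0 < a k" for k using b0 P by (simp add: a_def)
  have ac: "a k \<le> \<beta> * (1 / \<eta>) ^ k" for k
  proof -
    \<comment> \<open>This is why the exponent is \<open>Suc (k div l)\<close>: with it
      \<open>\<eta> ^ k\<close> stays below the denominator for every position inside the
      block.\<close>
    have "k < l * Suc (k div l)"
      using l by (metis dividend_less_times_div mult_Suc_right)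
    then have "\<eta> ^ k \<le> \<eta> ^ (l * Suc (k div l))" using \<eta> by (intro power_increasing) auto
    also have "\<dots> \<le> P ^ Suc (k div l)"
      unfolding power_mult using P(2) \<eta> by (metis of_int_power power_mono zero_le_power less_eq_real_def less_trans zero_less_one)
    finally have "a k \<le> \<beta> / \<eta> ^ k"
      unfolding a_def using \<eta> b\<beta>[of k] \<beta> by (intro frac_le) auto
    then show ?thesis by (simp add: power_one_over)
  qed
  have sa: "summable a"
    by (rule summable_comparison_test'[where N=0, OF summable_mult[OF summable_geometric[of "1/\<eta>"], of \<beta>]])
       (use \<eta> ac a0 in \<open>auto simp: less_imp_le\<close>)
  obtain B where B: "\<And>v. v \<in> V \<Longrightarrow> \<bar>real_of_int v\<bar> \<le> B"
    using V(1) by (metis finite_imageI finite_imp_bounded bounded_iff imageI real_norm_def)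
  have "\<exists>w (z::int). (\<forall>k. w k \<in> V) \<and> \<bar>(\<Sum>k. a k * real_of_int (w k)) - (x + z)\<bar> < \<epsilon>" if "\<epsilon> > 0" for x \<epsilon>
  proof -
    have t1: "(\<lambda>n. (\<Sum>k. a (k + n)) * B) \<longlonglongrightarrow> 0 * B"
      by (intro tendsto_intros suminf_exist_split2[OF sa])
    have t2: "(\<lambda>n. (1 / real_of_int P) ^ n) \<longlonglongrightarrow> 0"
      using P by (intro LIMSEQ_power_zero) auto
    have "\<forall>\<^sub>F n in sequentially. (\<Sum>k. a (k + n)) * B < \<epsilon> / 2"
      using order_tendstoD(2)[OF t1, of "\<epsilon> / 2"] that by simp
    moreover have "\<forall>\<^sub>F n in sequentially. (1 / real_of_int P) ^ n < \<epsilon> / 2"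
      using order_tendstoD(2)[OF t2, of "\<epsilon> / 2"] that by simp
    ultimately obtain n where "\<And>m. m \<ge> n \<Longrightarrow> (\<Sum>k. a (k + m)) * B < \<epsilon> / 2"
      and n2: "(1 / real_of_int P) ^ n < \<epsilon> / 2"
      unfolding eventually_sequentially by (metis nle_le order.trans)
    then have n1: "(\<Sum>k. a (k + n * l)) * B < \<epsilon> / 2" using l by simp
    \<comment> \<open>\<open>N / P ^ n\<close> is within \<open>1 / P ^ n\<close> of
      \<open>x\<close>. The multiple of \<open>P ^ n\<close> left over in the expansion of
      \<open>N\<close> becomes the integer \<open>z\<close> after division.\<close>
    define N where "N = \<lfloor>x * real_of_int P ^ n\<rfloor>"
    obtain w z where w: "\<forall>i. w i \<in> V"
      and wz: "(\<Sum>k<n * l. P ^ (n - Suc (k div l)) * b (k mod l) * w k) = N + z * P ^ n"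
      using block_expansion[OF l cov] by blast
    have aw: "\<bar>a k * real_of_int (w k)\<bar> \<le> a k * B" for k
      using a0[of k] B[of "w k"] w by (simp add: abs_mult mult_left_mono)
    have sw: "summable (\<lambda>k. a k * real_of_int (w k))"
      by (rule summable_comparison_test'[where N=0, OF summable_mult2[OF sa, of B]]) (use aw in auto)
    have "(\<Sum>k<n * l. a k * real_of_int (w k))
       = (\<Sum>k<n * l. real_of_int (P ^ (n - Suc (k div l)) * b (k mod l) * w k) / P ^ n)"
    proof (rule sum.cong)
      fix k assume "k \<in> {..<n * l}"
      then have "k div l < n" by (simp add: less_mult_imp_div_less)
      then have "real_of_int P ^ n = real_of_int P ^ (n - Suc (k div l)) * real_of_int P ^ Suc (k div l)"
        by (simp only: power_add[symmetric]) simp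
      then show "a k * real_of_int (w k) = real_of_int (P ^ (n - Suc (k div l)) * b (k mod l) * w k) / P ^ n"
        using P by (simp add: a_def)
    qed simp
    also have "\<dots> = real_of_int (N + z * P ^ n) / P ^ n"
      unfolding sum_divide_distrib[symmetric] of_int_sum[symmetric] wz by simp
    also have "\<dots> = N / P ^ n + z" using P by (simp add: add_divide_distrib)
    finally have head: "(\<Sum>k<n * l. a k * real_of_int (w k)) = N / P ^ n + z" .
    have "\<bar>N / P ^ n - x\<bar> = \<bar>N - x * real_of_int P ^ n\<bar> * (1 / real_of_int P) ^ n"
      using P by (simp add: field_simps power_one_over abs_if)
    also have "\<dots> \<le> 1 * (1 / real_of_int P) ^ n"
      using P unfolding N_def by (intro mult_right_mono) (auto simp: abs_le_iff, linarith+)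
    finally have r1: "\<bar>N / P ^ n - x\<bar> < \<epsilon> / 2" using n2 by simp
    have "\<bar>\<Sum>k. a (k + n * l) * real_of_int (w (k + n * l))\<bar> \<le> (\<Sum>k. a (k + n * l) * B)"
      using aw summable_ignore_initial_segment[OF summable_mult2[OF sa, of B], of "n * l"]
      by (subst real_norm_def[symmetric], intro norm_suminf_le) auto
    also have "\<dots> = (\<Sum>k. a (k + n * l)) * B"
      using summable_ignore_initial_segment[OF sa] by (rule suminf_mult2[symmetric])
    finally have r2: "\<bar>\<Sum>k. a (k + n * l) * real_of_int (w (k + n * l))\<bar> < \<epsilon> / 2" using n1 by simp
    have "(\<Sum>k. a k * real_of_int (w k)) = (\<Sum>k. a (k + n * l) * real_of_int (w (k + n * l))) + (N / P ^ n + z)"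
      using suminf_split_initial_segment[OF sw, of "n * l"] head by simp
    then have "\<bar>(\<Sum>k. a k * real_of_int (w k)) - (x + z)\<bar> < \<epsilon>" using r1 r2 by linarith
    then show ?thesis using w by blast
  qed
  then show ?thesis using that a0 ac by blast
qed

section \<open>Orthonormal bases and weak convergence\<close>

text \<open>In a complete space this is a Hilbert basis: totality replaces density of the span. The
  index type \<open>nat\<close> encodes separability and infinite dimension.\<close>

definition orthonormal_total :: "(nat \<Rightarrow> 'a::real_inner) \<Rightarrow> bool" where
  "orthonormal_total e \<longleftrightarrow> (\<forall>i j. e i \<bullet> e j = (if i = j then 1 else 0)) \<and>
     (\<forall>x. (\<forall>i. x \<bullet> e i = 0) \<longrightarrow> x = 0)"

text \<open>Zorn gives a maximal orthonormal set, and maximality gives totality. A finite total set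
  would span the space; countability follows since distinct elements have distance
  \<open>sqrt 2\<close> and cannot share a nearby point of a countable dense set.\<close>

lemma exists_orthonormal_total:
  assumes sep: "\<exists>D::('a::real_inner) set. countable D \<and> closure D = UNIV"
    and inf: "\<not> (\<exists>B::('a::real_inner) set. finite B \<and> span B = UNIV)"
  obtains e :: "nat \<Rightarrow> 'a::real_inner" where "orthonormal_total e"
proof -
  define \<A> where "\<A> = {B::'a set. \<forall>x\<in>B. \<forall>y\<in>B. x \<bullet> y = (if x = y then 1 else 0)}"
  have "\<Union>C \<in> \<A>" if "subset.chain \<A> C" for C
  proof -
    have "x \<bullet> y = (if x = y then 1 else 0)" if xy: "X \<in> C" "x \<in> X" "Y \<in> C" "y \<in> Y" for x y X Y
    proof -
      have "X \<subseteq> Y \<or> Y \<subseteq> X" "X \<in> \<A>" "Y \<in> \<A>"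
        using xy \<open>subset.chain \<A> C\<close> unfolding subset_chain_def by blast+
      then show ?thesis using xy unfolding \<A>_def by blast
    qed
    then show ?thesis unfolding \<A>_def by blast
  qed
  then obtain B where B: "B \<in> \<A>" and max: "\<And>X. X \<in> \<A> \<Longrightarrow> B \<subseteq> X \<Longrightarrow> X = B"
    using subset_Zorn'[of \<A>] by blast
  have on: "x \<bullet> y = (if x = y then 1 else 0)" if "x \<in> B" "y \<in> B" for x y
    using B that unfolding \<A>_def by blast
  have tot: "x = 0" if "\<forall>b\<in>B. x \<bullet> b = 0" for x
  proof (rule ccontr)
    assume x: "x \<noteq> 0"
    have one: "(x /\<^sub>R norm x) \<bullet> (x /\<^sub>R norm x) = 1"
    proof -
      have "x \<bullet> x = norm x * norm x" by (simp add: dot_square_norm power2_eq_square)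
      then have "(x /\<^sub>R norm x) \<bullet> (x /\<^sub>R norm x) = inverse (norm x) * (inverse (norm x) * (norm x * norm x))"
        by (simp only: inner_scaleR_left inner_scaleR_right)
      then show ?thesis using x by (simp add: mult.assoc[symmetric])
    qed
    define y where "y = x /\<^sub>R norm x"
    have y0: "y \<bullet> b = 0" "b \<bullet> y = 0" if "b \<in> B" for b
      using \<open>\<forall>b\<in>B. x \<bullet> b = 0\<close> that by (simp_all add: y_def inner_commute[of b])
    have yB: "y \<notin> B" using y0(1)[of y] one unfolding y_def by auto
    have "insert y B \<in> \<A>"
      unfolding \<A>_def
    proof (intro CollectI ballI)
      fix v w assume "v \<in> insert y B" "w \<in> insert y B"
      then show "v \<bullet> w = (if v = w then 1 else 0)"
        using on[of v w] y0[of v] y0[of w] yB one[folded y_def] by auto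
    qed
    then show False using max[of "insert y B"] yB by blast
  qed
  have "infinite B"
  proof
    assume fB: "finite B"
    have "x \<in> span B" for x
    proof -
      \<comment> \<open>The orthogonal projection onto the span of \<open>B\<close>; the remainder
        is orthogonal to \<open>B\<close> and vanishes by totality.\<close>
      define y where "y = (\<Sum>b\<in>B. (x \<bullet> b) *\<^sub>R b)"
      have "(x - y) \<bullet> b = 0" if "b \<in> B" for b
      proof -
        have "y \<bullet> b = (\<Sum>c\<in>B. if c = b then x \<bullet> b else 0)"
          unfolding y_def inner_sum_left using on that by (intro sum.cong) auto
        also have "\<dots> = x \<bullet> b" using fB that by simp
        finally show ?thesis by (simp add: inner_diff_left)
      qed
      then have "x - y = 0" by (intro tot) blast
      moreover have "y \<in> span B" unfolding y_def by (intro span_sum span_scale span_base)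
      ultimately show ?thesis by simp
    qed
    then show False using inf fB by blast
  qed
  moreover have "countable B"
  proof -
    obtain D :: "'a set" where D: "countable D" "closure D = UNIV" using sep by blast
    have "\<exists>d\<in>D. dist d b < 1/2" for b
      using closure_approachable[of b D] D(2) by (metis UNIV_I half_gt_zero zero_less_one)
    then obtain g where g: "\<And>b. g b \<in> D" "\<And>b. dist (g b) b < 1/2" by metis
    have "inj_on g B"
    proof (rule inj_onI)
      fix x y assume xy: "x \<in> B" "y \<in> B" "g x = g y"
      show "x = y"
      proof (rule ccontr)
        assume ne: "x \<noteq> y"
        have "(norm (x - y))\<^sup>2 = 2"
          using on xy ne by (simp add: power2_norm_eq_inner inner_diff_left inner_diff_right)
        moreover have "norm (x - y) < 1"
          using g(2)[of x] g(2)[of y] xy(3) dist_triangle3[of x y "g x"] by (simp add: dist_norm)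
        then have "(norm (x - y))\<^sup>2 < 1" by (simp add: power_less_one_iff abs_square_less_1)
        ultimately show False by simp
      qed
    qed
    then show ?thesis using g(1) D(1) by (meson countable_image_inj_on countable_subset image_subsetI)
  qed
  ultimately have "bij_betw (from_nat_into B) UNIV B" by (rule bij_betw_from_nat_into[rotated])
  then have "orthonormal_total (from_nat_into B)"
    unfolding orthonormal_total_def
  proof (intro conjI allI impI)
    fix i j
    have "from_nat_into B i \<in> B" "from_nat_into B j \<in> B"
         "from_nat_into B i = from_nat_into B j \<longleftrightarrow> i = j"
      using \<open>bij_betw (from_nat_into B) UNIV B\<close> by (auto simp: bij_betw_def inj_def)
    then show "from_nat_into B i \<bullet> from_nat_into B j = (if i = j then 1 else 0)"
      using on by metis
  next
    fix x assume "\<forall>i. x \<bullet> from_nat_into B i = 0"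
    then have "\<forall>b\<in>B. x \<bullet> b = 0"
      using \<open>bij_betw (from_nat_into B) UNIV B\<close> unfolding bij_betw_def by force
    then show "x = 0" by (rule tot)
  qed
  then show ?thesis by (rule that)
qed

text \<open>The sort of the ambient space does not entail class \<^class>\<open>banach\<close>, so the comparison test of
  the library does not apply to it.\<close>
lemma complete_summable_comparison:
  fixes f :: "nat \<Rightarrow> 'a::{real_normed_vector,complete_space}"
  assumes le: "\<And>n. norm (f n) \<le> g n" and g: "summable g"
  shows "summable f" "norm (suminf f) \<le> suminf g"
proof -
  have diff: "norm (sum f {..<n} - sum f {..<m}) \<le> \<bar>sum g {..<n} - sum g {..<m}\<bar>" if "m \<le> n" for m n
  proof -
    have "norm (sum f {..<n} - sum f {..<m}) = norm (sum f {m..<n})"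
      using that by (simp add: lessThan_atLeast0 sum_diff_nat_ivl)
    also have "\<dots> \<le> sum g {m..<n}" by (rule sum_norm_le[OF le])
    also have "\<dots> = sum g {..<n} - sum g {..<m}"
      using that by (simp add: lessThan_atLeast0 sum_diff_nat_ivl)
    finally show ?thesis by simp
  qed
  have dist: "dist (sum f {..<m}) (sum f {..<n}) \<le> dist (sum g {..<m}) (sum g {..<n})" for m n
    using diff[of m n] diff[of n m] by (cases "m \<le> n") (auto simp: dist_norm norm_minus_commute abs_minus_commute)
  have "Cauchy (\<lambda>n. sum g {..<n})"
    using g by (simp add: summable_iff_convergent convergent_Cauchy)
  have "Cauchy (\<lambda>n. sum f {..<n})"
  proof (rule metric_CauchyI)
    fix e :: real assume "e > 0"
    then obtain M where "\<forall>m\<ge>M. \<forall>n\<ge>M. dist (sum g {..<m}) (sum g {..<n}) < e"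
      using metric_CauchyD[OF \<open>Cauchy (\<lambda>n. sum g {..<n})\<close>] by blast
    then show "\<exists>M. \<forall>m\<ge>M. \<forall>n\<ge>M. dist (sum f {..<m}) (sum f {..<n}) < e"
      using le_less_trans[OF dist] by blast
  qed
  then show sf: "summable f"
    by (simp add: summable_iff_convergent Cauchy_convergent)
  have g0: "0 \<le> g n" for n using le[of n] norm_ge_zero[of "f n"] by linarith
  have "norm (sum f {..<n}) \<le> suminf g" for n
  proof -
    have "norm (sum f {..<n}) \<le> sum g {..<n}" by (rule sum_norm_le[OF le])
    also have "\<dots> \<le> suminf g" using g0 by (intro sum_le_suminf[OF g]) auto
    finally show ?thesis .
  qed
  then show "norm (suminf f) \<le> suminf g"
    using Lim_norm_ubound[OF _ summable_LIMSEQ[OF sf], of "suminf g"] by auto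
qed

text \<open>Uniform boundedness by Baire: the closed sets \<open>F N\<close> cover the space, so one
  of them contains a ball, and a bound on a ball bounds the norms of the functionals.\<close>

lemma weak_conv_bounded:
  fixes xs :: "nat \<Rightarrow> 'a::{real_inner,complete_space}"
  assumes "weak_conv xs x"
  obtains R where "\<And>n. norm (xs n) \<le> R"
proof -
  define F where "F = (\<lambda>N::nat. {v. \<forall>n. \<bar>xs n \<bullet> v\<bar> \<le> N})"
  have cl: "closed (F N)" for N
  proof -
    have "F N = (\<Inter>n. {v. \<bar>xs n \<bullet> v\<bar> \<le> N})" by (auto simp: F_def)
    moreover have "closed {v. \<bar>xs n \<bullet> v\<bar> \<le> N}" for n
      by (intro closed_Collect_le continuous_intros)
    ultimately show ?thesis by auto
  qed
  have "\<exists>N. v \<in> F N" for v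
  proof -
    have "Bseq (\<lambda>n. xs n \<bullet> v)"
      using assms unfolding weak_conv_def by (meson convergentI convergent_imp_Bseq)
    then obtain K where K: "\<And>n. \<bar>xs n \<bullet> v\<bar> \<le> K" by (auto simp: Bseq_def)
    obtain N :: nat where "K \<le> N" using real_arch_simple by blast
    then show ?thesis using K by (auto simp: F_def intro: order_trans)
  qed
  then have UN: "\<Union>(range F) = UNIV" by blast
  have "\<exists>N. interior (F N) \<noteq> {}"
  proof (rule ccontr)
    assume "\<not> ?thesis"
    then have "euclidean interior_of \<Union>(range F) = {}"
      using completely_metrizable_space_euclidean cl
      by (intro Baire_category_alt) auto
    then show False using UN by simp
  qed
  then obtain N v where "v \<in> interior (F N)" by blast
  then obtain r where r: "r > 0" "cball v r \<subseteq> F N"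
    by (meson interior_subset open_contains_cball open_interior subset_trans)
  have "norm (xs n) \<le> 2 * N / r" for n
  proof (cases "xs n = 0")
    case True
    then show ?thesis using r by simp
  next
    case False
    \<comment> \<open>The vector of length \<open>r\<close> in the direction of \<open>xs n\<close>.
      Subtracting the bounds at \<open>v + u\<close> and \<open>v\<close> leaves
      \<open>r * norm (xs n) \<le> 2 * N\<close>.\<close>
    define u where "u = (r / norm (xs n)) *\<^sub>R xs n"
    have "norm u = r" using False r by (simp add: u_def)
    then have "v + u \<in> F N" "v \<in> F N" using r by (auto simp: dist_norm subset_iff)
    then have "\<bar>xs n \<bullet> (v + u)\<bar> \<le> N" "\<bar>xs n \<bullet> v\<bar> \<le> N" by (auto simp: F_def)
    then have "xs n \<bullet> u \<le> 2 * N" by (simp add: inner_add_right)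
    moreover have "xs n \<bullet> u = r * norm (xs n)"
      using False by (simp add: u_def power2_norm_eq_inner[symmetric] power2_eq_square)
    ultimately show ?thesis using r by (simp add: field_simps)
  qed
  then show ?thesis by (rule that)
qed

section \<open>Diagonal series\<close>

text \<open>A single summable sequence \<open>\<gamma>\<close> controls values, derivatives and
  Lipschitz constants of the summands, and \<open>B\<close> holds the dependence on the radius.
  Since each coordinate is at most the norm, all series converge uniformly on balls. The system
  \<open>u\<close> may be incomplete, which leaves room for linear coordinates.\<close>

locale diagonal_series =
  fixes u :: "nat \<Rightarrow> 'a::{real_inner,complete_space}"
    and \<phi> \<phi>' :: "nat \<Rightarrow> real \<Rightarrow> real" and \<gamma> :: "nat \<Rightarrow> real" and B :: "real \<Rightarrow> real"
  assumes orthonormal: "u i \<bullet> u j = (if i = j then 1 else 0)"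
    and deriv: "(\<phi> k has_real_derivative \<phi>' k y) (at y)"
    and bound: "\<bar>y\<bar> \<le> R \<Longrightarrow> \<bar>\<phi> k y\<bar> \<le> \<gamma> k * B R"
    and bound': "\<bar>y\<bar> \<le> R \<Longrightarrow> \<bar>\<phi>' k y\<bar> \<le> \<gamma> k * B R"
    and lipschitz: "\<bar>y\<bar> \<le> R \<Longrightarrow> \<bar>z\<bar> \<le> R \<Longrightarrow> \<bar>\<phi>' k y - \<phi>' k z\<bar> \<le> \<gamma> k * B R * \<bar>y - z\<bar>"
    and summable: "summable \<gamma>"
begin

definition val :: "'a \<Rightarrow> real" where
  "val x = (\<Sum>k. \<phi> k (x \<bullet> u k))"

definition grad :: "'a \<Rightarrow> 'a" where
  "grad x = (\<Sum>k. \<phi>' k (x \<bullet> u k) *\<^sub>R u k)"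

lemma norm_u: "norm (u k) = 1"
  by (simp add: norm_eq_sqrt_inner orthonormal)

lemma abs_inner_u_le: "\<bar>x \<bullet> u k\<bar> \<le> norm x"
  using Cauchy_Schwarz_ineq2[of x "u k"] by (simp add: norm_u)

lemma summable_mult_B: "summable (\<lambda>k. \<gamma> k * c)"
  using summable by (rule summable_mult2)

lemma summable_val: "summable (\<lambda>k. \<phi> k (x \<bullet> u k))"
  by (rule summable_comparison_test'[where N=0, OF summable_mult_B[of "B (norm x)"]])
     (simp add: bound abs_inner_u_le)

lemma summable_grad: "summable (\<lambda>k. \<phi>' k (x \<bullet> u k) *\<^sub>R u k)"
  by (rule complete_summable_comparison[OF _ summable_mult_B[of "B (norm x)"]])
     (simp add: bound' abs_inner_u_le norm_u)

lemma grad_inner_sums: "(\<lambda>k. \<phi>' k (x \<bullet> u k) * (h \<bullet> u k)) sums (grad x \<bullet> h)"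
  using bounded_linear.sums[OF bounded_linear_inner_left[of h] summable_sums[OF summable_grad[of x]]]
  by (simp add: grad_def inner_commute)

lemma grad_inner_u: "grad x \<bullet> u k = \<phi>' k (x \<bullet> u k)"
proof -
  have "(\<lambda>j. \<phi>' j (x \<bullet> u j) * (u k \<bullet> u j)) = (\<lambda>j. if j = k then \<phi>' k (x \<bullet> u k) else 0)"
    by (auto simp: orthonormal)
  then show ?thesis
    using grad_inner_sums[of x "u k"] sums_single[of k "\<lambda>j. \<phi>' k (x \<bullet> u k)"] sums_unique2 by fastforce
qed

lemma grad_eq_0_iff: "grad x = 0 \<longleftrightarrow> (\<forall>k. \<phi>' k (x \<bullet> u k) = 0)"
  using grad_inner_u[of x] by (auto simp: grad_def)

text \<open>Termwise differentiation on a ball around 0 that contains \<open>x\<close>: the tails of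
  the derivative series are at most \<open>e * norm h\<close> uniformly there. The ball is open, so
  the derivative within it is the full derivative.\<close>

lemma val_has_derivative: "(val has_derivative (\<lambda>h. grad x \<bullet> h)) (at x)"
proof -
  define R where "R = norm x + 1"
  define S where "S = ball (0::'a) R"
  have xS: "x \<in> S" by (simp add: S_def R_def)
  have inR: "\<bar>y \<bullet> u k\<bar> \<le> R" if "y \<in> S" for y k
    using abs_inner_u_le[of y k] that by (simp add: S_def)
  have "\<exists>g. \<forall>x\<in>S. (\<lambda>n. \<phi> n (x \<bullet> u n)) sums (g x) \<and> (g has_derivative (\<lambda>h. grad x \<bullet> h)) (at x within S)"
  proof (rule has_derivative_series)
    show "convex S" by (simp add: S_def)
    show "((\<lambda>x. \<phi> n (x \<bullet> u n)) has_derivative (\<lambda>h. \<phi>' n (y \<bullet> u n) * (h \<bullet> u n))) (at y within S)" for n y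
      using has_derivative_compose[OF bounded_linear_imp_has_derivative[OF bounded_linear_inner_left[of "u n"]]
          deriv[of n, unfolded has_field_derivative_def]] by simp
    show "x \<in> S" by (rule xS)
    show "(\<lambda>n. \<phi> n (x \<bullet> u n)) sums val x"
      unfolding val_def by (rule summable_sums[OF summable_val])
    fix e :: real assume e: "e > 0"
    have "(\<lambda>n. \<Sum>k. \<gamma> (k + n) * B R) \<longlonglongrightarrow> 0"
      by (rule suminf_exist_split2[OF summable_mult_B])
    then have "\<forall>\<^sub>F n in sequentially. (\<Sum>k. \<gamma> (k + n) * B R) < e" using e by (rule order_tendstoD)
    then show "\<forall>\<^sub>F n in sequentially. \<forall>x\<in>S. \<forall>h.
        norm ((\<Sum>i<n. \<phi>' i (x \<bullet> u i) * (h \<bullet> u i)) - grad x \<bullet> h) \<le> e * norm h"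
    proof (rule eventually_mono, intro ballI allI)
      fix n y h assume n: "(\<Sum>k. \<gamma> (k + n) * B R) < e" and y: "y \<in> S"
      have "norm ((\<Sum>i<n. \<phi>' i (y \<bullet> u i) * (h \<bullet> u i)) - grad y \<bullet> h)
          = norm (\<Sum>i. \<phi>' (i + n) (y \<bullet> u (i + n)) * (h \<bullet> u (i + n)))"
        using grad_inner_sums[of y h] suminf_split_initial_segment[of "\<lambda>i. \<phi>' i (y \<bullet> u i) * (h \<bullet> u i)" n]
        by (simp add: sums_iff norm_minus_commute)
      also have "\<dots> \<le> (\<Sum>k. \<gamma> (k + n) * B R * norm h)"
      proof (rule norm_suminf_le)
        show "norm (\<phi>' (i + n) (y \<bullet> u (i + n)) * (h \<bullet> u (i + n))) \<le> \<gamma> (i + n) * B R * norm h" for i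
        proof -
          have le: "\<bar>\<phi>' (i + n) (y \<bullet> u (i + n))\<bar> \<le> \<gamma> (i + n) * B R" by (rule bound'[OF inR[OF y]])
          have "\<bar>\<phi>' (i + n) (y \<bullet> u (i + n))\<bar> * \<bar>h \<bullet> u (i + n)\<bar> \<le> \<gamma> (i + n) * B R * norm h"
            by (rule mult_mono[OF le abs_inner_u_le order_trans[OF abs_ge_zero le] abs_ge_zero])
          then show ?thesis by (simp add: abs_mult)
        qed
        show "summable (\<lambda>k. \<gamma> (k + n) * B R * norm h)"
          using summable_ignore_initial_segment[OF summable_mult_B[of "B R * norm h"], of n]
          by (simp add: mult.assoc)
      qed
      also have "\<dots> = (\<Sum>k. \<gamma> (k + n) * B R) * norm h"
        using summable_ignore_initial_segment[OF summable_mult_B] by (rule suminf_mult2[symmetric])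
      also have "\<dots> \<le> e * norm h" using n by (intro mult_right_mono) auto
      finally show "norm ((\<Sum>i<n. \<phi>' i (y \<bullet> u i) * (h \<bullet> u i)) - grad y \<bullet> h) \<le> e * norm h" .
    qed
  qed
  then obtain g where g: "\<And>y. y \<in> S \<Longrightarrow> (\<lambda>n. \<phi> n (y \<bullet> u n)) sums (g y)"
    and g': "(g has_derivative (\<lambda>h. grad x \<bullet> h)) (at x within S)" using xS by blast
  have "val y = g y" if "y \<in> S" for y
    using g[OF that] by (simp add: val_def sums_iff)
  then have "(val has_derivative (\<lambda>h. grad x \<bullet> h)) (at x within S)"
    using has_derivative_transform[OF xS _ g'] by blast
  moreover have "at x within S = at x" using xS by (intro at_within_open) (auto simp: S_def)
  ultimately show ?thesis by simp
qed

lemma norm_grad_diff_le: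
  "norm (grad x - grad y) \<le> (\<Sum>k. \<bar>\<phi>' k (x \<bullet> u k) - \<phi>' k (y \<bullet> u k)\<bar>)"
proof -
  have s: "summable (\<lambda>k. \<bar>\<phi>' k (z \<bullet> u k)\<bar>)" for z
    by (rule summable_comparison_test'[where N=0, OF summable_mult_B[of "B (norm z)"]])
       (simp add: bound' abs_inner_u_le)
  have "grad x - grad y = (\<Sum>k. (\<phi>' k (x \<bullet> u k) - \<phi>' k (y \<bullet> u k)) *\<^sub>R u k)"
    unfolding grad_def by (subst suminf_diff[OF summable_grad summable_grad]) (simp add: scaleR_diff_left)
  also have "norm \<dots> \<le> (\<Sum>k. \<bar>\<phi>' k (x \<bullet> u k) - \<phi>' k (y \<bullet> u k)\<bar>)"
    by (rule complete_summable_comparison)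
       (simp add: norm_u, rule summable_comparison_test'[where N=0, OF summable_add[OF s[of x] s[of y]]], simp)
  finally show ?thesis .
qed

lemma grad_lipschitz:
  assumes "norm x \<le> R" "norm y \<le> R"
  shows "norm (grad x - grad y) \<le> (\<Sum>k. \<gamma> k * B R) * norm (x - y)"
proof -
  have le: "\<bar>\<phi>' k (x \<bullet> u k) - \<phi>' k (y \<bullet> u k)\<bar> \<le> \<gamma> k * B R * norm (x - y)" for k
  proof -
    have R: "\<bar>x \<bullet> u k\<bar> \<le> R" "\<bar>y \<bullet> u k\<bar> \<le> R" using assms abs_inner_u_le by (meson order_trans)+
    have "0 \<le> \<gamma> k * B R" using bound'[OF R(1), of k] by (meson abs_ge_zero order_trans)
    moreover have "\<bar>x \<bullet> u k - y \<bullet> u k\<bar> \<le> norm (x - y)"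
      using abs_inner_u_le[of "x - y" k] by (simp add: inner_diff_left)
    ultimately show ?thesis using lipschitz[OF R, of k] by (meson mult_left_mono order_trans)
  qed
  have sm: "summable (\<lambda>k. \<gamma> k * B R * norm (x - y))"
    by (rule summable_mult2[OF summable_mult_B])
  have "norm (grad x - grad y) \<le> (\<Sum>k. \<bar>\<phi>' k (x \<bullet> u k) - \<phi>' k (y \<bullet> u k)\<bar>)"
    by (rule norm_grad_diff_le)
  also have "\<dots> \<le> (\<Sum>k. \<gamma> k * B R * norm (x - y))"
    by (rule suminf_le[OF le _ sm]) (rule summable_comparison_test'[where N=0, OF sm], simp add: le)
  also have "\<dots> = (\<Sum>k. \<gamma> k * B R) * norm (x - y)"
    by (rule suminf_mult2[symmetric, OF summable_mult_B])
  finally show ?thesis .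
qed

text \<open>A weakly convergent sequence is bounded and converges in each coordinate. Dominated
  convergence over \<open>k\<close>, with majorant \<open>\<gamma> k * (2 * B R)\<close>, turns this
  into norm convergence of the gradients.\<close>

lemma grad_weak_conv:
  assumes "weak_conv xs x"
  shows "(\<lambda>n. grad (xs n)) \<longlonglongrightarrow> grad x"
proof -
  obtain R0 where R0: "\<And>n. norm (xs n) \<le> R0" using weak_conv_bounded[OF assms] by blast
  define R where "R = max R0 (norm x)"
  have R: "\<bar>xs n \<bullet> u k\<bar> \<le> R" "\<bar>x \<bullet> u k\<bar> \<le> R" for n k
    unfolding R_def using R0 abs_inner_u_le by (meson max.coboundedI1 max.coboundedI2 order_trans)+
  \<comment> \<open>Continuity comes from the Lipschitz bound on the ball of radius
    \<open>\<bar>y\<bar> + 1\<close>, which contains a neighbourhood of \<open>y\<close>.\<close>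
  have cont: "isCont (\<phi>' k) y" for k y
  proof -
    have "(\<lambda>z. \<gamma> k * B (\<bar>y\<bar> + 1) * \<bar>z - y\<bar>) \<midarrow>y\<rightarrow> \<gamma> k * B (\<bar>y\<bar> + 1) * \<bar>y - y\<bar>"
      by (intro tendsto_intros)
    then have "(\<lambda>z. \<phi>' k z - \<phi>' k y) \<midarrow>y\<rightarrow> 0"
    proof (rule Lim_null_comparison[rotated, where g="\<lambda>z. \<gamma> k * B (\<bar>y\<bar> + 1) * \<bar>z - y\<bar>", OF tendsto_eq_rhs])
      show "\<forall>\<^sub>F z in at y. norm (\<phi>' k z - \<phi>' k y) \<le> \<gamma> k * B (\<bar>y\<bar> + 1) * \<bar>z - y\<bar>"
        unfolding eventually_at by (rule exI[of _ 1]) (auto simp: dist_real_def intro!: lipschitz)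
    qed simp
    then show ?thesis unfolding isCont_def by (simp add: LIM_zero_iff)
  qed
  have lim: "(\<lambda>n. \<bar>\<phi>' k (xs n \<bullet> u k) - \<phi>' k (x \<bullet> u k)\<bar>) \<longlonglongrightarrow> 0" for k
  proof -
    have "(\<lambda>n. xs n \<bullet> u k) \<longlonglongrightarrow> x \<bullet> u k" using assms by (simp add: weak_conv_def)
    then have "(\<lambda>n. \<phi>' k (xs n \<bullet> u k)) \<longlonglongrightarrow> \<phi>' k (x \<bullet> u k)"
      by (rule isCont_tendsto_compose[OF cont])
    then show ?thesis by (simp add: LIM_zero tendsto_rabs_zero)
  qed
  have "\<bar>\<phi>' k (xs n \<bullet> u k) - \<phi>' k (x \<bullet> u k)\<bar> \<le> \<gamma> k * (2 * B R)" for k n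
    using bound'[OF R(1)[of n k], of k] bound'[OF R(2)[of k], of k] by linarith
  then have "(\<lambda>n. \<Sum>k. \<bar>\<phi>' k (xs n \<bullet> u k) - \<phi>' k (x \<bullet> u k)\<bar>) \<longlonglongrightarrow> (\<Sum>k. 0)"
    using tannerys_theorem[where a="\<lambda>k n. \<bar>\<phi>' k (xs n \<bullet> u k) - \<phi>' k (x \<bullet> u k)\<bar>" and b="\<lambda>_. 0",
        OF lim _ summable_mult_B[of "2 * B R"]] by (simp add: case_prod_unfold)
  then have "(\<lambda>n. \<Sum>k. \<bar>\<phi>' k (xs n \<bullet> u k) - \<phi>' k (x \<bullet> u k)\<bar>) \<longlonglongrightarrow> 0" by simp
  then have "(\<lambda>n. grad (xs n) - grad x) \<longlonglongrightarrow> 0"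
    by (rule Lim_null_comparison[rotated]) (simp add: norm_grad_diff_le)
  then show ?thesis by (rule LIM_zero_cancel)
qed

end

section \<open>Scaled polynomials as summands\<close>

lemma abs_poly_scaled_le:
  fixes p :: "real poly"
  assumes "degree p \<le> n" "t \<ge> 1" "\<bar>y\<bar> \<le> R"
  shows "\<bar>poly p (t * y)\<bar> \<le> t ^ n * ((\<Sum>i\<le>n. \<bar>coeff p i\<bar>) * (max 1 R) ^ n)"
proof -
  have "poly p (t * y) = (\<Sum>i\<le>n. coeff p i * (t * y) ^ i)"
    unfolding poly_altdef using assms(1) by (intro sum.mono_neutral_left) (auto simp: coeff_eq_0)
  also have "\<bar>\<dots>\<bar> \<le> (\<Sum>i\<le>n. \<bar>coeff p i\<bar> * (t ^ n * (max 1 R) ^ n))"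
  proof (rule order_trans[OF sum_abs], rule sum_mono)
    fix i assume i: "i \<in> {..n}"
    have "\<bar>t * y\<bar> ^ i \<le> (t * max 1 R) ^ i"
      using assms by (intro power_mono) (auto simp: abs_mult intro!: mult_mono)
    also have "\<dots> \<le> (t * max 1 R) ^ n"
      using assms(2) i mult_mono[of 1 t 1 "max 1 R"] by (intro power_increasing) auto
    finally show "\<bar>coeff p i * (t * y) ^ i\<bar> \<le> \<bar>coeff p i\<bar> * (t ^ n * (max 1 R) ^ n)"
      by (simp add: abs_mult power_abs power_mult_distrib mult_left_mono)
  qed
  also have "\<dots> = t ^ n * ((\<Sum>i\<le>n. \<bar>coeff p i\<bar>) * (max 1 R) ^ n)"
    by (simp add: sum_distrib_left sum_distrib_right algebra_simps)
  finally show ?thesis .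
qed

text \<open>Each differentiation gains a factor \<open>q ^ k\<close> and lowers the degree by one,
  so all derivatives are of order \<open>(q ^ k) ^ d\<close>. Adding up the coefficients of
  \<open>p\<close> and its first two derivatives gives one constant for all three bounds.\<close>

lemma diagonal_series_poly:
  fixes u :: "nat \<Rightarrow> 'a::{real_inner,complete_space}" and p :: "real poly"
  assumes on: "\<And>i j. u i \<bullet> u j = (if i = j then 1 else 0)"
    and p: "degree p \<le> d" and d: "d \<ge> 2" and q: "q \<ge> 1"
    and a: "\<And>k. a k \<ge> 0" "summable (\<lambda>k. a k * (q ^ k) ^ d)"
  shows "diagonal_series u (\<lambda>k y. a k * poly p (q ^ k * y)) (\<lambda>k y. a k * q ^ k * poly (pderiv p) (q ^ k * y))
     (\<lambda>k. a k * (q ^ k) ^ d)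
     (\<lambda>R. (\<Sum>i\<le>d. \<bar>coeff p i\<bar> + \<bar>coeff (pderiv p) i\<bar> + \<bar>coeff (pderiv (pderiv p)) i\<bar>) * (max 1 R) ^ d)"
    (is "diagonal_series u ?\<phi> ?\<phi>' ?\<gamma> ?B")
proof
  have t: "q ^ k \<ge> 1" for k using q by simp
  \<comment> \<open>Used with \<open>j\<close> equal to 0, 1 and 2 for \<open>p\<close>, its
    derivative and its second derivative.\<close>
  have B: "\<bar>(q ^ k) ^ j * poly r (q ^ k * y)\<bar> \<le> (q ^ k) ^ d * ?B R"
    if "\<bar>y\<bar> \<le> R" "degree r \<le> d - j" "j \<le> d" and c: "\<And>i. \<bar>coeff r i\<bar> \<le> \<bar>coeff p i\<bar> + \<bar>coeff (pderiv p) i\<bar> + \<bar>coeff (pderiv (pderiv p)) i\<bar>"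
    for r j k y R
  proof -
    have "\<bar>(q ^ k) ^ j * poly r (q ^ k * y)\<bar> \<le> (q ^ k) ^ j * ((q ^ k) ^ (d - j) * ((\<Sum>i\<le>d - j. \<bar>coeff r i\<bar>) * (max 1 R) ^ (d - j)))"
      using abs_poly_scaled_le[OF that(2) t that(1), of k] q by (simp add: abs_mult mult_left_mono)
    also have "\<dots> = (q ^ k) ^ d * ((\<Sum>i\<le>d - j. \<bar>coeff r i\<bar>) * (max 1 R) ^ (d - j))"
      using that(3) by (simp add: mult.assoc[symmetric] power_add[symmetric])
    also have "\<dots> \<le> (q ^ k) ^ d * ?B R"
    proof (intro mult_left_mono mult_mono)
      have "(\<Sum>i\<le>d - j. \<bar>coeff r i\<bar>) \<le> (\<Sum>i\<le>d. \<bar>coeff r i\<bar>)" by (intro sum_mono2) auto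
      also have "\<dots> \<le> (\<Sum>i\<le>d. \<bar>coeff p i\<bar> + \<bar>coeff (pderiv p) i\<bar> + \<bar>coeff (pderiv (pderiv p)) i\<bar>)"
        by (intro sum_mono c)
      finally show "(\<Sum>i\<le>d - j. \<bar>coeff r i\<bar>) \<le> (\<Sum>i\<le>d. \<bar>coeff p i\<bar> + \<bar>coeff (pderiv p) i\<bar> + \<bar>coeff (pderiv (pderiv p)) i\<bar>)" .
      show "max 1 R ^ (d - j) \<le> max 1 R ^ d" by (intro power_increasing) auto
    qed (use q in \<open>auto intro!: sum_nonneg\<close>)
    finally show ?thesis .
  qed
  have dp: "degree (pderiv p) \<le> d - 1" "degree (pderiv (pderiv p)) \<le> d - 2"
    using p by (auto simp: degree_pderiv)
  have scale: "\<bar>a k * z\<bar> \<le> ?\<gamma> k * ?B R" if "\<bar>z\<bar> \<le> (q ^ k) ^ d * ?B R" for k z R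
    using mult_left_mono[OF that a(1)[of k]] a(1)[of k] by (simp add: abs_mult mult.assoc)
  show "u i \<bullet> u j = (if i = j then 1 else 0)" for i j by (rule on)
  show "(?\<phi> k has_real_derivative ?\<phi>' k y) (at y)" for k y
    by (auto intro!: derivative_eq_intros)
  show "\<bar>?\<phi> k y\<bar> \<le> ?\<gamma> k * ?B R" if "\<bar>y\<bar> \<le> R" for k y R
    using B[OF that, of p 0 k] p by (intro scale) simp
  show "\<bar>?\<phi>' k y\<bar> \<le> ?\<gamma> k * ?B R" if "\<bar>y\<bar> \<le> R" for k y R
    using B[OF that dp(1), of k] d scale[of "q ^ k * poly (pderiv p) (q ^ k * y)" k R]
    by (simp add: mult.assoc)
  show "\<bar>?\<phi>' k y - ?\<phi>' k z\<bar> \<le> ?\<gamma> k * ?B R * \<bar>y - z\<bar>" if "\<bar>y\<bar> \<le> R" "\<bar>z\<bar> \<le> R" for k y z R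
  proof -
    have "norm (?\<phi>' k y - ?\<phi>' k z) \<le> ?\<gamma> k * ?B R * norm (y - z)"
    proof (rule field_differentiable_bound[of "cball 0 R"])
      show "(?\<phi>' k has_field_derivative a k * ((q ^ k)\<^sup>2 * poly (pderiv (pderiv p)) (q ^ k * x))) (at x within cball 0 R)" for x
        by (auto intro!: derivative_eq_intros simp: power2_eq_square)
      show "norm (a k * ((q ^ k)\<^sup>2 * poly (pderiv (pderiv p)) (q ^ k * x))) \<le> ?\<gamma> k * ?B R" if "x \<in> cball 0 R" for x
        using B[of x R "pderiv (pderiv p)" 2 k] dp(2) d that unfolding real_norm_def by (intro scale) simp
    qed (use that in auto)
    then show ?thesis by simp
  qed
  show "summable ?\<gamma>" by (rule a(2))
qed

section \<open>Polynomial restrictions\<close>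

lemma finite_multi_idx: "finite (multi_idx n d)"
proof (rule finite_subset)
  show "multi_idx n d \<subseteq> {\<alpha>. \<forall>i. (i \<in> {..<n} \<longrightarrow> \<alpha> i \<in> {..d}) \<and> (i \<notin> {..<n} \<longrightarrow> \<alpha> i = 0)}"
  proof (clarsimp simp: multi_idx_def)
    fix \<alpha> :: "nat \<Rightarrow> nat" and i assume "sum \<alpha> {..<n} \<le> d" "i < n"
    then show "\<alpha> i \<le> d" using member_le_sum[of i "{..<n}" \<alpha>] by simp
  qed
  show "finite {\<alpha>. \<forall>i. (i \<in> {..<n} \<longrightarrow> \<alpha> i \<in> {..d}) \<and> (i \<notin> {..<n} \<longrightarrow> \<alpha> i = 0)}"
    by (rule finite_set_of_finite_funs) auto
qed

lemma multi_idx_mono: "j \<le> d \<Longrightarrow> multi_idx n j \<subseteq> multi_idx n d"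
  by (auto simp: multi_idx_def)

lemma sum_upd_lessThan:
  fixes \<alpha> :: "nat \<Rightarrow> nat"
  assumes "i < n"
  shows "(\<Sum>k<n. (\<alpha>(i := m)) k) + \<alpha> i = (\<Sum>k<n. \<alpha> k) + m"
proof -
  have "(\<Sum>k\<in>{..<n} - {i}. (\<alpha>(i := m)) k) = (\<Sum>k\<in>{..<n} - {i}. \<alpha> k)" by (rule sum.cong) auto
  then show ?thesis
    using assms by (simp add: sum.remove[of "{..<n}" i])
qed

text \<open>A multinomial expansion by induction on \<open>j\<close>. The bound on the coefficients
  is what later allows them to be summed over infinitely many linear forms.\<close>

lemma linear_form_power_coeffs:
  fixes \<beta> :: "nat \<Rightarrow> real"
  shows "\<exists>c. (\<forall>t. (\<Sum>i<n. t i * \<beta> i) ^ j = (\<Sum>\<alpha>\<in>multi_idx n j. (\<Prod>i<n. t i ^ \<alpha> i) * c \<alpha>)) \<and>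
             (\<forall>\<alpha>. \<bar>c \<alpha>\<bar> \<le> (\<Sum>i<n. \<bar>\<beta> i\<bar>) ^ j)"
proof (induction j)
  case 0
  have "multi_idx n 0 = {\<lambda>_. 0}"
    by (auto simp: multi_idx_def fun_eq_iff) (meson lessThan_iff linorder_not_less)
  then show ?case by (intro exI[of _ "\<lambda>_. 1"]) simp
next
  case (Suc j)
  then obtain c where c: "\<And>t. (\<Sum>i<n. t i * \<beta> i) ^ j = (\<Sum>\<alpha>\<in>multi_idx n j. (\<Prod>i<n. t i ^ \<alpha> i) * c \<alpha>)"
     and cb: "\<And>\<alpha>. \<bar>c \<alpha>\<bar> \<le> (\<Sum>i<n. \<bar>\<beta> i\<bar>) ^ j" by blast
  \<comment> \<open>Multiplication by \<open>t i * \<beta> i\<close> raises exponent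
    \<open>i\<close>, so the coefficient at \<open>\<alpha>\<close> collects those at
    \<open>\<alpha>\<close> with one exponent lowered.\<close>
  define c' where "c' = (\<lambda>\<alpha>. \<Sum>i<n. if \<alpha> i > 0 then \<beta> i * c (\<alpha>(i := \<alpha> i - 1)) else 0)"
  have "(\<Sum>i<n. t i * \<beta> i) ^ Suc j = (\<Sum>\<alpha>\<in>multi_idx n (Suc j). (\<Prod>i<n. t i ^ \<alpha> i) * c' \<alpha>)" for t
  proof -
    have step: "(\<Sum>\<alpha>\<in>multi_idx n j. t i * \<beta> i * ((\<Prod>k<n. t k ^ \<alpha> k) * c \<alpha>))
      = (\<Sum>\<alpha>\<in>multi_idx n (Suc j). if \<alpha> i > 0 then (\<Prod>k<n. t k ^ \<alpha> k) * (\<beta> i * c (\<alpha>(i := \<alpha> i - 1))) else 0)"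
      if i: "i < n" for i
    proof -
      have mon: "(\<Prod>k<n. t k ^ (\<alpha>(i := Suc (\<alpha> i))) k) = t i * (\<Prod>k<n. t k ^ \<alpha> k)" for \<alpha>
      proof -
        have "(\<Prod>k\<in>{..<n} - {i}. t k ^ (\<alpha>(i := Suc (\<alpha> i))) k) = (\<Prod>k\<in>{..<n} - {i}. t k ^ \<alpha> k)"
          by (rule prod.cong) auto
        then show ?thesis using i by (simp add: prod.remove[of "{..<n}" i])
      qed
      have "(\<Sum>\<alpha>\<in>multi_idx n j. t i * \<beta> i * ((\<Prod>k<n. t k ^ \<alpha> k) * c \<alpha>))
         = (\<Sum>\<alpha>\<in>{\<alpha> \<in> multi_idx n (Suc j). \<alpha> i > 0}. (\<Prod>k<n. t k ^ \<alpha> k) * (\<beta> i * c (\<alpha>(i := \<alpha> i - 1))))"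
      proof (rule sum.reindex_bij_witness[of _ "\<lambda>\<alpha>. \<alpha>(i := \<alpha> i - 1)" "\<lambda>\<alpha>. \<alpha>(i := Suc (\<alpha> i))"])
        fix \<alpha> assume a: "\<alpha> \<in> multi_idx n j"
        show "\<alpha>(i := Suc (\<alpha> i)) \<in> {\<alpha> \<in> multi_idx n (Suc j). \<alpha> i > 0}"
          using a i sum_upd_lessThan[OF i, of \<alpha> "Suc (\<alpha> i)"] by (auto simp: multi_idx_def)
        show "(\<Prod>k<n. t k ^ (\<alpha>(i := Suc (\<alpha> i))) k) * (\<beta> i * c ((\<alpha>(i := Suc (\<alpha> i)))(i := (\<alpha>(i := Suc (\<alpha> i))) i - 1)))
           = t i * \<beta> i * ((\<Prod>k<n. t k ^ \<alpha> k) * c \<alpha>)"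
          unfolding mon by simp
      next
        fix \<alpha> assume a: "\<alpha> \<in> {\<alpha> \<in> multi_idx n (Suc j). \<alpha> i > 0}"
        show "\<alpha>(i := \<alpha> i - 1) \<in> multi_idx n j"
          using a i sum_upd_lessThan[OF i, of \<alpha> "\<alpha> i - 1"] by (auto simp: multi_idx_def)
      qed auto
      also have "\<dots> = (\<Sum>\<alpha>\<in>multi_idx n (Suc j). if \<alpha> i > 0 then (\<Prod>k<n. t k ^ \<alpha> k) * (\<beta> i * c (\<alpha>(i := \<alpha> i - 1))) else 0)"
        by (rule sum.inter_filter[OF finite_multi_idx])
      finally show ?thesis .
    qed
    have "(\<Sum>i<n. t i * \<beta> i) ^ Suc j = (\<Sum>i<n. \<Sum>\<alpha>\<in>multi_idx n j. t i * \<beta> i * ((\<Prod>k<n. t k ^ \<alpha> k) * c \<alpha>))"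
      by (simp add: c sum_product)
    also have "\<dots> = (\<Sum>i<n. \<Sum>\<alpha>\<in>multi_idx n (Suc j). if \<alpha> i > 0 then (\<Prod>k<n. t k ^ \<alpha> k) * (\<beta> i * c (\<alpha>(i := \<alpha> i - 1))) else 0)"
      by (intro sum.cong step) auto
    also have "\<dots> = (\<Sum>\<alpha>\<in>multi_idx n (Suc j). \<Sum>i<n. if \<alpha> i > 0 then (\<Prod>k<n. t k ^ \<alpha> k) * (\<beta> i * c (\<alpha>(i := \<alpha> i - 1))) else 0)"
      by (rule sum.swap)
    also have "\<dots> = (\<Sum>\<alpha>\<in>multi_idx n (Suc j). (\<Prod>i<n. t i ^ \<alpha> i) * c' \<alpha>)"
      unfolding c'_def sum_distrib_left by (intro sum.cong refl) auto
    finally show ?thesis .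
  qed
  moreover have "\<bar>c' \<alpha>\<bar> \<le> (\<Sum>i<n. \<bar>\<beta> i\<bar>) ^ Suc j" for \<alpha>
  proof -
    have "\<bar>c' \<alpha>\<bar> \<le> (\<Sum>i<n. \<bar>\<beta> i\<bar> * (\<Sum>i<n. \<bar>\<beta> i\<bar>) ^ j)"
      unfolding c'_def
      by (rule order_trans[OF sum_abs], rule sum_mono)
         (auto simp: abs_mult intro!: mult_left_mono cb mult_nonneg_nonneg zero_le_power sum_nonneg)
    then show ?thesis by (simp add: sum_distrib_right)
  qed
  ultimately show ?case by (intro exI[of _ c'] conjI allI)
qed

lemma poly_linear_form_coeffs:
  fixes p :: "real poly" and \<beta> :: "nat \<Rightarrow> real"
  assumes p: "degree p \<le> d" and s: "s \<ge> 1" and R: "(\<Sum>i<n. \<bar>\<beta> i\<bar>) \<le> R"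
  shows "\<exists>c. (\<forall>t. poly p (s * (\<Sum>i<n. t i * \<beta> i)) = (\<Sum>\<alpha>\<in>multi_idx n d. (\<Prod>i<n. t i ^ \<alpha> i) * c \<alpha>)) \<and>
             (\<forall>\<alpha>. \<bar>c \<alpha>\<bar> \<le> s ^ d * ((\<Sum>i\<le>d. \<bar>coeff p i\<bar>) * (max 1 R) ^ d))"
proof -
  have "\<exists>C. \<forall>j. (\<forall>t. (\<Sum>i<n. t i * \<beta> i) ^ j = (\<Sum>\<alpha>\<in>multi_idx n j. (\<Prod>i<n. t i ^ \<alpha> i) * C j \<alpha>)) \<and>
      (\<forall>\<alpha>. \<bar>C j \<alpha>\<bar> \<le> (\<Sum>i<n. \<bar>\<beta> i\<bar>) ^ j)"
    by (rule choice, rule allI, rule linear_form_power_coeffs)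
  then obtain C where C: "\<And>j t. (\<Sum>i<n. t i * \<beta> i) ^ j = (\<Sum>\<alpha>\<in>multi_idx n j. (\<Prod>i<n. t i ^ \<alpha> i) * C j \<alpha>)"
      and Cb: "\<And>j \<alpha>. \<bar>C j \<alpha>\<bar> \<le> (\<Sum>i<n. \<bar>\<beta> i\<bar>) ^ j"
    by (elim exE) blast
  \<comment> \<open>Extension by zero brings the powers of different degrees to the common index set
    \<open>multi_idx n d\<close>.\<close>
  define C' where "C' = (\<lambda>j \<alpha>. if \<alpha> \<in> multi_idx n j then C j \<alpha> else 0)"
  define c where "c = (\<lambda>\<alpha>. \<Sum>j\<le>d. coeff p j * s ^ j * C' j \<alpha>)"
  have "poly p (s * (\<Sum>i<n. t i * \<beta> i)) = (\<Sum>\<alpha>\<in>multi_idx n d. (\<Prod>i<n. t i ^ \<alpha> i) * c \<alpha>)" for t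
  proof -
    have pow: "(\<Sum>i<n. t i * \<beta> i) ^ j = (\<Sum>\<alpha>\<in>multi_idx n d. (\<Prod>i<n. t i ^ \<alpha> i) * C' j \<alpha>)" if "j \<le> d" for j
      unfolding C by (rule sum.mono_neutral_cong_left[OF finite_multi_idx multi_idx_mono[OF that]])
        (auto simp: C'_def)
    have "poly p (s * (\<Sum>i<n. t i * \<beta> i)) = (\<Sum>j\<le>d. coeff p j * (s * (\<Sum>i<n. t i * \<beta> i)) ^ j)"
      unfolding poly_altdef using p by (intro sum.mono_neutral_left) (auto simp: coeff_eq_0)
    also have "\<dots> = (\<Sum>j\<le>d. \<Sum>\<alpha>\<in>multi_idx n d. (\<Prod>i<n. t i ^ \<alpha> i) * (coeff p j * s ^ j * C' j \<alpha>))"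
    proof (rule sum.cong[OF refl])
      fix j assume "j \<in> {..d}"
      then have "coeff p j * (s * (\<Sum>i<n. t i * \<beta> i)) ^ j
          = coeff p j * s ^ j * (\<Sum>\<alpha>\<in>multi_idx n d. (\<Prod>i<n. t i ^ \<alpha> i) * C' j \<alpha>)"
        unfolding power_mult_distrib by (subst pow) auto
      then show "coeff p j * (s * (\<Sum>i<n. t i * \<beta> i)) ^ j
          = (\<Sum>\<alpha>\<in>multi_idx n d. (\<Prod>i<n. t i ^ \<alpha> i) * (coeff p j * s ^ j * C' j \<alpha>))"
        by (simp only: sum_distrib_left mult_ac)
    qed
    also have "\<dots> = (\<Sum>\<alpha>\<in>multi_idx n d. (\<Prod>i<n. t i ^ \<alpha> i) * c \<alpha>)"
      unfolding c_def sum_distrib_left by (rule sum.swap)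
    finally show ?thesis .
  qed
  moreover have "\<bar>c \<alpha>\<bar> \<le> s ^ d * ((\<Sum>i\<le>d. \<bar>coeff p i\<bar>) * (max 1 R) ^ d)" for \<alpha>
  proof -
    have "\<bar>c \<alpha>\<bar> \<le> (\<Sum>j\<le>d. \<bar>coeff p j\<bar> * (s ^ d * (max 1 R) ^ d))"
      unfolding c_def
    proof (rule order_trans[OF sum_abs], rule sum_mono)
      fix j assume j: "j \<in> {..d}"
      have "\<bar>C' j \<alpha>\<bar> \<le> (\<Sum>i<n. \<bar>\<beta> i\<bar>) ^ j" using Cb by (auto simp: C'_def sum_nonneg)
      also have "\<dots> \<le> (max 1 R) ^ j" using R by (intro power_mono) (auto simp: sum_nonneg)
      also have "\<dots> \<le> (max 1 R) ^ d" using j by (intro power_increasing) auto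
      finally have "s ^ j * \<bar>C' j \<alpha>\<bar> \<le> s ^ d * (max 1 R) ^ d"
        using s j by (intro mult_mono power_increasing) auto
      then show "\<bar>coeff p j * s ^ j * C' j \<alpha>\<bar> \<le> \<bar>coeff p j\<bar> * (s ^ d * (max 1 R) ^ d)"
        using s by (simp add: abs_mult mult.assoc mult_left_mono)
    qed
    then show ?thesis by (simp add: sum_distrib_left sum_distrib_right mult_ac)
  qed
  ultimately show ?thesis by (intro exI[of _ c] conjI allI)
qed

lemma restr_poly_vecI:
  fixes f :: "'a::real_vector \<Rightarrow> real ^ 'm"
  assumes "\<And>i. restr_poly (\<lambda>x. f x $ i) d"
  shows "restr_poly f d"
  unfolding restr_poly_def
proof (intro allI impI)
  fix bs :: "'a list" assume bs: "distinct bs \<and> independent (set bs)"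
  have "\<forall>i. \<exists>c. \<forall>t. f (\<Sum>k<length bs. t k *\<^sub>R bs ! k) $ i
     = (\<Sum>\<alpha>\<in>multi_idx (length bs) d. (\<Prod>k<length bs. t k ^ \<alpha> k) *\<^sub>R c \<alpha>)"
    using assms bs unfolding restr_poly_def by blast
  then obtain c where c: "\<And>i t. f (\<Sum>k<length bs. t k *\<^sub>R bs ! k) $ i
     = (\<Sum>\<alpha>\<in>multi_idx (length bs) d. (\<Prod>k<length bs. t k ^ \<alpha> k) *\<^sub>R c i \<alpha>)" by (drule_tac choice) blast
  then show "\<exists>c. \<forall>t. f (\<Sum>k<length bs. t k *\<^sub>R bs ! k)
     = (\<Sum>\<alpha>\<in>multi_idx (length bs) d. (\<Prod>k<length bs. t k ^ \<alpha> k) *\<^sub>R c \<alpha>)"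
    by (intro exI[of _ "\<lambda>\<alpha>. \<chi> i. c i \<alpha>"]) (simp add: vec_eq_iff)
qed

lemma restr_poly_inner:
  fixes v :: "'a::real_inner"
  assumes "d \<ge> 1"
  shows "restr_poly (\<lambda>x. x \<bullet> v) d"
  unfolding restr_poly_def
proof (intro allI impI)
  fix bs :: "'a list"
  have "degree [:0, 1::real:] \<le> d" using assms by simp
  from poly_linear_form_coeffs[OF this order_refl order_refl, where n="length bs" and \<beta>="\<lambda>i. bs ! i \<bullet> v"]
  show "\<exists>c. \<forall>t. (\<Sum>i<length bs. t i *\<^sub>R bs ! i) \<bullet> v
     = (\<Sum>\<alpha>\<in>multi_idx (length bs) d. (\<Prod>i<length bs. t i ^ \<alpha> i) *\<^sub>R c \<alpha>)"
    by (auto simp: inner_sum_left)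
qed

text \<open>Every summand is a polynomial in \<open>t\<close> with coefficients of order
  \<open>(q ^ k) ^ d\<close>, uniformly in the multi-index. Summability of
  \<open>a k * (q ^ k) ^ d\<close> allows the series to be summed coefficient by
  coefficient.\<close>

lemma restr_poly_series:
  fixes u :: "nat \<Rightarrow> 'a::real_inner" and p :: "real poly"
  assumes u: "\<And>k. norm (u k) = 1" and p: "degree p \<le> d" and q: "q \<ge> 1"
    and a: "\<And>k. a k \<ge> 0" "summable (\<lambda>k. a k * (q ^ k) ^ d)"
  shows "restr_poly (\<lambda>x. \<Sum>k. a k * poly p (q ^ k * (x \<bullet> u k))) d"
  unfolding restr_poly_def
proof (intro allI impI)
  fix bs :: "'a list"
  define n where "n = length bs"
  define R where "R = (\<Sum>i<n. norm (bs ! i))"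
  define S where "S = (\<Sum>i\<le>d. \<bar>coeff p i\<bar>) * (max 1 R) ^ d"
  have "(\<Sum>i<n. \<bar>bs ! i \<bullet> u k\<bar>) \<le> R" for k
    unfolding R_def using Cauchy_Schwarz_ineq2[of _ "u k"] u by (intro sum_mono) (metis mult.right_neutral)
  then have "\<exists>c. \<forall>k. (\<forall>t. poly p (q ^ k * (\<Sum>i<n. t i * (bs ! i \<bullet> u k)))
        = (\<Sum>\<alpha>\<in>multi_idx n d. (\<Prod>i<n. t i ^ \<alpha> i) * c k \<alpha>)) \<and> (\<forall>\<alpha>. \<bar>c k \<alpha>\<bar> \<le> (q ^ k) ^ d * S)"
    unfolding S_def using q by (intro choice allI poly_linear_form_coeffs[OF p]) auto
  then obtain c where c: "\<And>k t. poly p (q ^ k * (\<Sum>i<n. t i * (bs ! i \<bullet> u k)))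
        = (\<Sum>\<alpha>\<in>multi_idx n d. (\<Prod>i<n. t i ^ \<alpha> i) * c k \<alpha>)"
      and cb: "\<And>k \<alpha>. \<bar>c k \<alpha>\<bar> \<le> (q ^ k) ^ d * S" by (elim exE) blast
  have sm: "summable (\<lambda>k. a k * c k \<alpha>)" for \<alpha>
  proof (rule summable_comparison_test'[where N=0, OF summable_mult2[OF a(2), of S]])
    show "norm (a k * c k \<alpha>) \<le> a k * (q ^ k) ^ d * S" for k
      using mult_left_mono[OF cb a(1)[of k]] a(1)[of k] by (simp add: abs_mult mult.assoc)
  qed
  have "(\<Sum>k. a k * poly p (q ^ k * ((\<Sum>i<n. t i *\<^sub>R bs ! i) \<bullet> u k)))
      = (\<Sum>\<alpha>\<in>multi_idx n d. (\<Prod>i<n. t i ^ \<alpha> i) *\<^sub>R (\<Sum>k. a k * c k \<alpha>))" for t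
  proof -
    have "(\<Sum>k. a k * poly p (q ^ k * ((\<Sum>i<n. t i *\<^sub>R bs ! i) \<bullet> u k)))
        = (\<Sum>k. \<Sum>\<alpha>\<in>multi_idx n d. (\<Prod>i<n. t i ^ \<alpha> i) * (a k * c k \<alpha>))"
      unfolding inner_sum_left inner_scaleR_left c unfolding sum_distrib_left by (simp only: mult_ac)
    also have "\<dots> = (\<Sum>\<alpha>\<in>multi_idx n d. \<Sum>k. (\<Prod>i<n. t i ^ \<alpha> i) * (a k * c k \<alpha>))"
      by (rule suminf_sum) (rule summable_mult[OF sm])
    finally show ?thesis by (simp add: suminf_mult[OF sm])
  qed
  then show "\<exists>c. \<forall>t. (\<Sum>k. a k * poly p (q ^ k * ((\<Sum>i<length bs. t i *\<^sub>R bs ! i) \<bullet> u k)))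
      = (\<Sum>\<alpha>\<in>multi_idx (length bs) d. (\<Prod>i<length bs. t i ^ \<alpha> i) *\<^sub>R c \<alpha>)"
    unfolding n_def by (intro exI allI)
qed

section \<open>Boxes and Kolmogorov widths\<close>

lemma orthonormal_series:
  fixes e :: "nat \<Rightarrow> 'a::{real_inner,complete_space}"
  assumes e: "orthonormal_total e" and y: "\<And>k. \<bar>y k\<bar> \<le> \<tau> k" and \<tau>: "summable \<tau>"
  shows "summable (\<lambda>k. y k *\<^sub>R e k)" "norm (\<Sum>k. y k *\<^sub>R e k) \<le> suminf \<tau>"
    "(\<Sum>k. y k *\<^sub>R e k) \<bullet> e j = y j"
proof -
  have on: "e i \<bullet> e j = (if i = j then 1 else 0)" for i j using e by (simp add: orthonormal_total_def)
  have n: "norm (y k *\<^sub>R e k) \<le> \<tau> k" for k using y by (simp add: norm_eq_sqrt_inner on)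
  show s: "summable (\<lambda>k. y k *\<^sub>R e k)" "norm (\<Sum>k. y k *\<^sub>R e k) \<le> suminf \<tau>"
    using complete_summable_comparison[OF n \<tau>] by auto
  have "(\<lambda>k. (y k *\<^sub>R e k) \<bullet> e j) sums ((\<Sum>k. y k *\<^sub>R e k) \<bullet> e j)"
    by (rule bounded_linear.sums[OF bounded_linear_inner_left summable_sums[OF s(1)]])
  moreover have "(\<lambda>k. (y k *\<^sub>R e k) \<bullet> e j) = (\<lambda>k. if k = j then y j else 0)" by (auto simp: on)
  ultimately show "(\<Sum>k. y k *\<^sub>R e k) \<bullet> e j = y j"
    using sums_single[of j "\<lambda>_. y j"] sums_unique2 by fastforce
qed

lemma orthonormal_expansion:
  fixes e :: "nat \<Rightarrow> 'a::{real_inner,complete_space}"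
  assumes e: "orthonormal_total e" and x: "\<And>k. \<bar>x \<bullet> e k\<bar> \<le> \<tau> k" and \<tau>: "summable \<tau>"
  shows "(\<Sum>k. (x \<bullet> e k) *\<^sub>R e k) = x"
proof -
  have "((\<Sum>k. (x \<bullet> e k) *\<^sub>R e k) - x) \<bullet> e j = 0" for j
    unfolding inner_diff_left by (subst orthonormal_series(3)[OF e x \<tau>]) simp
  then have "(\<Sum>k. (x \<bullet> e k) *\<^sub>R e k) - x = 0" using e unfolding orthonormal_total_def by blast
  then show ?thesis by simp
qed

lemma norm_orthonormal_tail_le:
  fixes e :: "nat \<Rightarrow> 'a::{real_inner,complete_space}"
  assumes e: "orthonormal_total e" and y: "\<And>k. \<bar>y k\<bar> \<le> \<tau> k" and \<tau>: "summable \<tau>"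
  shows "norm ((\<Sum>k. y k *\<^sub>R e k) - (\<Sum>k<n. y k *\<^sub>R e k)) \<le> (\<Sum>k. \<tau> (k + n))"
proof -
  have "(\<Sum>k. y k *\<^sub>R e k) - (\<Sum>k<n. y k *\<^sub>R e k) = (\<Sum>k. y (k + n) *\<^sub>R e (k + n))"
    using suminf_split_initial_segment[OF orthonormal_series(1)[OF assms], of n] by simp
  also have "norm \<dots> \<le> (\<Sum>k. \<tau> (k + n))"
  proof (rule complete_summable_comparison)
    show "norm (y (k + n) *\<^sub>R e (k + n)) \<le> \<tau> (k + n)" for k
      using y[of "k + n"] e by (simp add: norm_eq_sqrt_inner orthonormal_total_def)
    show "summable (\<lambda>k. \<tau> (k + n))" by (rule summable_ignore_initial_segment[OF \<tau>])
  qed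
  finally show ?thesis .
qed

text \<open>The box is the image of a compact product of intervals under the coordinate series.\<close>
lemma compact_orthonormal_box:
  fixes e :: "nat \<Rightarrow> 'a::{real_inner,complete_space}"
  assumes e: "orthonormal_total e" and \<tau>: "summable \<tau>"
  shows "compact {x. \<forall>k. \<bar>x \<bullet> e k\<bar> \<le> \<tau> k}"
proof -
  define Y where "Y = PiE UNIV (\<lambda>k. {-\<tau> k..\<tau> k})"
  \<comment> \<open>Tychonoff for the product of intervals.\<close>
  have "compactin (product_topology (\<lambda>_. euclidean) UNIV) Y"
    unfolding Y_def compactin_PiE by simp
  then have Y: "compact Y" by (simp add: euclidean_product_topology)
  have Yb: "\<bar>y k\<bar> \<le> \<tau> k" if "y \<in> Y" for y k
  proof -
    have "y k \<in> {-\<tau> k..\<tau> k}" using that by (auto simp: Y_def PiE_def Pi_def)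
    then show ?thesis by (simp add: abs_le_iff)
  qed
  have "continuous_on Y (\<lambda>y. \<Sum>k. y k *\<^sub>R e k)"
  proof (rule uniform_limit_theorem)
    show "\<forall>\<^sub>F n in sequentially. continuous_on Y (\<lambda>y. \<Sum>k<n. y k *\<^sub>R e k)"
      by (intro always_eventually allI continuous_intros continuous_on_subset[OF continuous_on_product_coordinates]) auto
    \<comment> \<open>Uniformity holds because the tails of \<open>\<tau>\<close> bound the error
      for all points of \<open>Y\<close> at once.\<close>
    show "uniform_limit Y (\<lambda>n y. \<Sum>k<n. y k *\<^sub>R e k) (\<lambda>y. \<Sum>k. y k *\<^sub>R e k) sequentially"
      unfolding uniform_limit_iff
    proof (intro allI impI)
      fix \<epsilon> :: real assume "\<epsilon> > 0"
      then have "\<forall>\<^sub>F n in sequentially. (\<Sum>k. \<tau> (k + n)) < \<epsilon>"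
        by (rule order_tendstoD(2)[OF suminf_exist_split2[OF \<tau>]])
      then show "\<forall>\<^sub>F n in sequentially. \<forall>y\<in>Y. dist (\<Sum>k<n. y k *\<^sub>R e k) (\<Sum>k. y k *\<^sub>R e k) < \<epsilon>"
      proof (rule eventually_mono, intro ballI)
        fix n y assume n: "(\<Sum>k. \<tau> (k + n)) < \<epsilon>" and y: "y \<in> Y"
        show "dist (\<Sum>k<n. y k *\<^sub>R e k) (\<Sum>k. y k *\<^sub>R e k) < \<epsilon>"
          using norm_orthonormal_tail_le[OF e Yb[OF y] \<tau>, of n] n by (simp add: dist_norm norm_minus_commute)
      qed
    qed
  qed simp
  then have "compact ((\<lambda>y. \<Sum>k. y k *\<^sub>R e k) ` Y)" by (rule compact_continuous_image[OF _ Y])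
  moreover have "(\<lambda>y. \<Sum>k. y k *\<^sub>R e k) ` Y = {x. \<forall>k. \<bar>x \<bullet> e k\<bar> \<le> \<tau> k}"
  proof (intro equalityI subsetI)
    fix x assume "x \<in> (\<lambda>y. \<Sum>k. y k *\<^sub>R e k) ` Y"
    then obtain y where y: "y \<in> Y" and x: "x = (\<Sum>k. y k *\<^sub>R e k)" by blast
    show "x \<in> {x. \<forall>k. \<bar>x \<bullet> e k\<bar> \<le> \<tau> k}"
      using orthonormal_series(3)[OF e Yb[OF y] \<tau>] Yb[OF y] unfolding x by simp
  next
    fix x assume "x \<in> {x. \<forall>k. \<bar>x \<bullet> e k\<bar> \<le> \<tau> k}"
    then have x: "\<bar>x \<bullet> e k\<bar> \<le> \<tau> k" for k by blast
    have "(\<lambda>k. x \<bullet> e k) \<in> Y" using x by (auto simp: Y_def abs_le_iff minus_le_iff)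
    then show "x \<in> (\<lambda>y. \<Sum>k. y k *\<^sub>R e k) ` Y"
      using orthonormal_expansion[OF e x \<tau>] by (intro image_eqI[of _ _ "\<lambda>k. x \<bullet> e k"]) simp_all
  qed
  ultimately show ?thesis by simp
qed

text \<open>One subspace bounds the infimum from above. Real suprema and infima need bounded sets:
  each subspace contains 0, so distances to it are bounded on \<open>K\<close>, and the suprema are
  nonnegative.\<close>

lemma kwidth_bounds:
  fixes K :: "'a::real_normed_vector set"
  assumes K: "bounded K" and B: "independent B" "finite B" "card B = n"
    and c: "\<And>u. u \<in> K \<Longrightarrow> infdist u (span B) \<le> c" "0 \<le> c"
  shows "0 \<le> kwidth n K" "kwidth n K \<le> c"
proof -
  define \<E> where "\<E> = {E. \<exists>B::'a set. independent B \<and> finite B \<and> card B = n \<and> span B = E}"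
  define w where "w = (\<lambda>E. SUP u\<in>K. infdist u E)"
  have BE: "span B \<in> \<E>" using B by (auto simp: \<E>_def)
  have "0 \<le> kwidth n K \<and> kwidth n K \<le> c"
  proof (cases "K = {}")
    case True
    then show ?thesis using c(2) by (simp add: kwidth_def)
  next
    case False
    then obtain u where u: "u \<in> K" by blast
    obtain R where R: "\<And>u. u \<in> K \<Longrightarrow> norm u \<le> R" using K by (auto simp: bounded_iff)
    have w0: "0 \<le> w E" if "E \<in> \<E>" for E
    proof -
      have "0 \<in> E" using that by (auto simp: \<E>_def span_zero)
      then have "infdist v E \<le> R" if "v \<in> K" for v
        using infdist_le[of 0 E v] R[OF that] by simp
      then have "bdd_above ((\<lambda>u. infdist u E) ` K)" by (auto simp: bdd_above_def)
      then have "infdist u E \<le> w E" unfolding w_def using u by (intro cSUP_upper)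
      then show ?thesis using infdist_nonneg[of u E] by linarith
    qed
    have eq: "kwidth n K = (INF E\<in>\<E>. w E)" using False by (simp add: kwidth_def \<E>_def w_def)
    have "0 \<le> (INF E\<in>\<E>. w E)" using BE w0 by (intro cINF_greatest) auto
    moreover have "(INF E\<in>\<E>. w E) \<le> w (span B)"
      using w0 BE by (intro cINF_lower) (auto simp: bdd_below_def)
    moreover have "w (span B) \<le> c" unfolding w_def using False c(1) by (intro cSUP_least) auto
    ultimately show ?thesis unfolding eq by linarith
  qed
  then show "0 \<le> kwidth n K" "kwidth n K \<le> c" by auto
qed

text \<open>The test subspace is spanned by the first \<open>n\<close> basis vectors; the truncation
  error is a geometric tail.\<close>

lemma kwidth_geometric_box:
  fixes e :: "nat \<Rightarrow> 'a::{real_inner,complete_space}"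
  assumes e: "orthonormal_total e" and q: "q > 1" and K: "K \<subseteq> {x. \<forall>k. \<bar>x \<bullet> e k\<bar> \<le> \<beta> * (1 / q) ^ k}"
    and \<beta>: "\<beta> \<ge> 0"
  shows "0 \<le> kwidth n K" "kwidth n K \<le> \<beta> / (1 - 1 / q) * (1 / q) ^ n"
proof -
  have on: "e i \<bullet> e j = (if i = j then 1 else 0)" for i j using e by (simp add: orthonormal_total_def)
  have inj: "inj e" using on by (metis injI zero_neq_one)
  have ind: "independent (e ` {..<n})"
  proof (rule pairwise_orthogonal_independent)
    show "pairwise orthogonal (e ` {..<n})" by (auto simp: pairwise_def orthogonal_def on)
    show "0 \<notin> e ` {..<n}" using on by (metis imageE inner_zero_left zero_neq_one)
  qed
  have \<tau>: "summable (\<lambda>k. \<beta> * (1 / q) ^ k)" using q by (intro summable_mult summable_geometric) auto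
  have bK: "bounded K"
    using compact_imp_bounded[OF compact_orthonormal_box[OF e \<tau>]] bounded_subset K by blast
  have inf: "infdist u (span (e ` {..<n})) \<le> \<beta> / (1 - 1 / q) * (1 / q) ^ n" if "u \<in> K" for u
  proof (rule infdist_le2)
    show "(\<Sum>k<n. (u \<bullet> e k) *\<^sub>R e k) \<in> span (e ` {..<n})"
      by (intro span_sum span_scale span_base) auto
    have u: "\<bar>u \<bullet> e k\<bar> \<le> \<beta> * (1 / q) ^ k" for k using K that by blast
    have "dist u (\<Sum>k<n. (u \<bullet> e k) *\<^sub>R e k) \<le> (\<Sum>k. \<beta> * (1 / q) ^ (k + n))"
      using norm_orthonormal_tail_le[OF e u \<tau>, of n] unfolding orthonormal_expansion[OF e u \<tau>] dist_norm .
    also have "\<dots> = (\<Sum>k. \<beta> * (1 / q) ^ n * (1 / q) ^ k)" by (simp add: power_add mult_ac)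
    also have "\<dots> = \<beta> * (1 / q) ^ n * (1 / (1 - 1 / q))"
      using q by (subst suminf_mult) (auto simp: suminf_geometric)
    finally show "dist u (\<Sum>k<n. (u \<bullet> e k) *\<^sub>R e k) \<le> \<beta> / (1 - 1 / q) * (1 / q) ^ n"
      by (simp add: mult_ac)
  qed
  have "card (e ` {..<n}) = n" using inj by (simp add: card_image inj_on_subset)
  moreover have "0 \<le> \<beta> / (1 - 1 / q) * (1 / q) ^ n" using q \<beta> by simp
  ultimately show "0 \<le> kwidth n K" "kwidth n K \<le> \<beta> / (1 - 1 / q) * (1 / q) ^ n"
    using kwidth_bounds[OF bK ind finite_imageI[OF finite_lessThan] _ inf] by blast+
qed

lemma limsup_root_geometric_le:
  assumes w: "\<And>n. 0 \<le> w n" "\<And>n. w n \<le> c * (1 / q) ^ n" and q: "q > 0" and c: "c > 0"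
  shows "limsup (\<lambda>n. ereal (w n powr (1 / real n))) \<le> ereal (1 / q)"
proof -
  have le: "w n powr (1 / real n) \<le> c powr (1 / real n) * (1 / q)" if "n > 0" for n
  proof -
    have "w n powr (1 / real n) \<le> (c * (1 / q) ^ n) powr (1 / real n)"
      using w by (intro powr_mono2) auto
    also have "\<dots> = c powr (1 / real n) * ((1 / q) ^ n) powr (1 / real n)"
      using c q by (intro powr_mult)
    also have "((1 / q) ^ n) powr (1 / real n) = 1 / q"
      using that q by (simp add: powr_realpow[symmetric] powr_powr)
    finally show ?thesis .
  qed
  \<comment> \<open>Only \<open>n > 0\<close> is compared, since \<open>1 / real 0\<close> is 0. The
    root of the constant \<open>c\<close> tends to 1.\<close>
  have "limsup (\<lambda>n. ereal (w n powr (1 / real n))) \<le> limsup (\<lambda>n. ereal (c powr (1 / real n) * (1 / q)))"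
    using le by (intro Limsup_mono eventually_mono[OF eventually_gt_at_top[of 0]]) simp
  also have "\<dots> = ereal (1 / q)"
  proof (rule lim_imp_Limsup)
    have "(\<lambda>n::nat. c powr (1 / real n) * (1 / q)) \<longlonglongrightarrow> 1 / q" using c by real_asymp
    then show "(\<lambda>n. ereal (c powr (1 / real n) * (1 / q))) \<longlonglongrightarrow> ereal (1 / q)" by simp
  qed simp
  finally show ?thesis .
qed

section \<open>Adding linear coordinates\<close>

text \<open>The first \<open>M\<close> basis vectors carry the linear components, numbered by
  \<open>\<pi>\<close>, and the series of component \<open>i0\<close> uses the remaining ones. The
  bijection forces \<open>M\<close> to be one less than the dimension of the target.\<close>

locale suspended_series = diagonal_series "\<lambda>k. e (k + M)" \<phi> \<phi>' \<gamma> B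
  for e :: "nat \<Rightarrow> 'a::{real_inner,complete_space}" and M \<phi> \<phi>' \<gamma> B +
  fixes i0 :: "'m::finite" and \<pi> :: "'m \<Rightarrow> nat"
  assumes e_orthonormal: "e i \<bullet> e j = (if i = j then 1 else 0)"
    and bij: "bij_betw \<pi> (UNIV - {i0}) {..<M}"
begin

definition F :: "'a \<Rightarrow> real ^ 'm" where
  "F x = (\<chi> i. if i = i0 then val x else x \<bullet> e (\<pi> i))"

definition dF :: "'a \<Rightarrow> 'a \<Rightarrow> real ^ 'm" where
  "dF x h = (\<chi> i. if i = i0 then grad x \<bullet> h else h \<bullet> e (\<pi> i))"

lemma F_has_derivative: "(F has_derivative dF x) (at x)"
  unfolding has_derivative_componentwise_within[of F]
proof
  fix b :: "real ^ 'm" assume "b \<in> Basis"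
  then obtain i where b: "b = axis i 1" by (auto simp: Basis_vec_def)
  show "((\<lambda>x. F x \<bullet> b) has_derivative (\<lambda>h. dF x h \<bullet> b)) (at x)"
    unfolding b by (cases "i = i0")
      (auto simp: inner_axis F_def dF_def val_has_derivative
            intro!: bounded_linear_imp_has_derivative bounded_linear_inner_left)
qed

lemma Dfr_F: "blinfun_apply (Dfr F x) = dF x"
proof -
  have "frechet_derivative F (at x) = dF x" using frechet_derivative_at[OF F_has_derivative] by simp
  then show ?thesis
    unfolding Dfr_def using has_derivative_bounded_linear[OF F_has_derivative]
    by (simp add: bounded_linear_Blinfun_apply)
qed

text \<open>The linear components have constant derivative, so only component \<open>i0\<close>
  changes. Regularity of \<open>F\<close> thus reduces to that of \<open>grad\<close>.\<close>

lemma norm_Dfr_F_diff: "norm (Dfr F x - Dfr F y) \<le> norm (grad x - grad y)"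
proof (rule norm_blinfun_bound)
  fix h
  have "blinfun_apply (Dfr F x - Dfr F y) h = ((grad x - grad y) \<bullet> h) *\<^sub>R axis i0 1"
    by (simp add: blinfun.diff_left Dfr_F dF_def vec_eq_iff axis_def inner_diff_left)
  then show "norm (blinfun_apply (Dfr F x - Dfr F y) h) \<le> norm (grad x - grad y) * norm h"
    by (simp add: Cauchy_Schwarz_ineq2)
qed simp

lemma F_in_Pclass:
  assumes "restr_poly F d"
  shows "F \<in> Pclass d"
  unfolding Pclass_def
proof (intro CollectI conjI allI impI)
  show "F differentiable (at x)" for x using F_has_derivative by (auto simp: differentiable_def)
  show lip: "\<exists>r>0. \<exists>L. \<forall>y\<in>ball x r. \<forall>z\<in>ball x r. norm (Dfr F y - Dfr F z) \<le> L * dist y z" for x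
  proof (intro exI conjI ballI)
    show "(1::real) > 0" by simp
    fix y z assume yz: "y \<in> ball x 1" "z \<in> ball x 1"
    have "norm y \<le> norm x + 1" if "y \<in> ball x 1" for y
      using that norm_triangle_ineq2[of y x] by (simp add: dist_norm norm_minus_commute)
    then have "norm (grad y - grad z) \<le> (\<Sum>k. \<gamma> k * B (norm x + 1)) * dist y z"
      unfolding dist_norm using yz by (intro grad_lipschitz) auto
    then show "norm (Dfr F y - Dfr F z) \<le> (\<Sum>k. \<gamma> k * B (norm x + 1)) * dist y z"
      using norm_Dfr_F_diff order_trans by blast
  qed
  show weak: "(\<lambda>n. Dfr F (xs n)) \<longlonglongrightarrow> Dfr F x" if "weak_conv xs x" for xs x
  proof -
    have "(\<lambda>n. norm (grad (xs n) - grad x)) \<longlonglongrightarrow> 0"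
      using grad_weak_conv[OF that] by (simp add: LIM_zero tendsto_norm_zero)
    then have "(\<lambda>n. Dfr F (xs n) - Dfr F x) \<longlonglongrightarrow> 0"
      by (rule Lim_null_comparison[rotated]) (simp add: norm_Dfr_F_diff)
    then show ?thesis by (rule LIM_zero_cancel)
  qed
  \<comment> \<open>Norm convergence implies weak convergence, so continuity is a special case of
    weak sequential continuity.\<close>
  show "continuous_on UNIV (Dfr F)"
  proof (rule continuous_at_imp_continuous_on, intro ballI)
    fix x
    have "Dfr F \<midarrow>x\<rightarrow> Dfr F x"
    proof (rule iffD1[OF LIMSEQ_SEQ_conv], intro allI impI)
      fix xs assume "(\<forall>n. xs n \<noteq> x) \<and> xs \<longlonglongrightarrow> x"
      then have "weak_conv xs x" unfolding weak_conv_def by (auto intro: tendsto_inner)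
      then show "(\<lambda>n. Dfr F (xs n)) \<longlonglongrightarrow> Dfr F x" by (rule weak)
    qed
    then show "isCont (Dfr F) x" by (simp add: isCont_def)
  qed
  show "restr_poly F d" by fact
qed

text \<open>The linear components already have full rank among themselves and see only the first
  \<open>M\<close> vectors. The rank drops exactly when the gradient of the series vanishes.\<close>

lemma Crit_F: "Crit F = {x. \<forall>k. \<phi>' k (x \<bullet> e (k + M)) = 0}"
proof (intro set_eqI iffI)
  fix x assume x: "x \<in> Crit F"
  show "x \<in> {x. \<forall>k. \<phi>' k (x \<bullet> e (k + M)) = 0}"
  proof (rule ccontr)
    assume "\<not> ?thesis"
    then obtain k where k: "\<phi>' k (x \<bullet> e (k + M)) \<noteq> 0" by blast
    define g where "g = \<phi>' k (x \<bullet> e (k + M))"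
    have \<pi>M: "\<pi> i < M" if "i \<noteq> i0" for i using bij that by (auto simp: bij_betw_def)
    have inj: "\<pi> i = \<pi> j \<longleftrightarrow> i = j" if "i \<noteq> i0" "j \<noteq> i0" for i j
      using bij that by (auto simp: bij_betw_def inj_on_def)
    have "y \<in> range (dF x)" for y
    proof -
      \<comment> \<open>Solves \<open>dF x h = y\<close>: \<open>h0\<close> matches the linear
        components, then a multiple of \<open>e (k + M)\<close> corrects component \<open>i0\<close>
        without disturbing the others.\<close>
      define h0 where "h0 = (\<Sum>j\<in>UNIV - {i0}. y $ j *\<^sub>R e (\<pi> j))"
      define h where "h = h0 + ((y $ i0 - grad x \<bullet> h0) / g) *\<^sub>R e (k + M)"
      have "h0 \<bullet> e (\<pi> i) = y $ i" if "i \<noteq> i0" for i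
      proof -
        have "h0 \<bullet> e (\<pi> i) = (\<Sum>j\<in>UNIV - {i0}. if j = i then y $ i else 0)"
          unfolding h0_def inner_sum_left using that inj by (intro sum.cong) (auto simp: e_orthonormal)
        then show ?thesis using that by simp
      qed
      moreover have "e (k + M) \<bullet> e (\<pi> i) = 0" if "i \<noteq> i0" for i
        using \<pi>M[OF that] by (simp add: e_orthonormal)
      moreover have "grad x \<bullet> h = y $ i0"
        using k by (simp add: h_def inner_add_right grad_inner_u g_def)
      ultimately have "dF x h = y"
        by (simp add: dF_def vec_eq_iff h_def inner_add_left)
      then show ?thesis by blast
    qed
    then have "range (dF x) = UNIV" by blast
    then have "dim (range (dF x)) = CARD('m)" by simp
    then show False using x unfolding Crit_def Dfr_F mem_Collect_eq
      by (metis diff_less leD zero_less_card_finite zero_less_one)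
  qed
next
  fix x assume "x \<in> {x. \<forall>k. \<phi>' k (x \<bullet> e (k + M)) = 0}"
  then have "grad x = 0" by (simp add: grad_eq_0_iff)
  then have sub: "range (dF x) \<subseteq> {y. axis i0 1 \<bullet> y = 0}" by (auto simp: dF_def inner_axis')
  have "dim (range (dF x)) \<noteq> CARD('m)"
  proof
    assume "dim (range (dF x)) = CARD('m)"
    then have "span (range (dF x)) = UNIV" using dim_eq_full[of "range (dF x)"] by simp
    moreover have "span (range (dF x)) \<subseteq> {y. axis i0 1 \<bullet> y = 0}"
      by (rule span_minimal[OF sub subspace_hyperplane])
    ultimately have "axis i0 (1::real) \<in> {y. axis i0 1 \<bullet> y = 0}" by blast
    then show False by (simp add: inner_axis_axis)
  qed
  then show "x \<in> Crit F"
    using dim_subset_UNIV_cart[of "range (dF x)"] by (simp add: Crit_def Dfr_F)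
qed

end

section \<open>The counterexample\<close>

lemma real_poly_critical_points:
  fixes p :: "int poly"
  assumes p: "pderiv p = smult \<kappa> (\<Prod>c\<in>C. [:-c, 1:])" and C: "finite C" and \<kappa>: "\<kappa> \<noteq> 0"
  shows "poly (pderiv (map_poly real_of_int p)) y = 0 \<longleftrightarrow> y \<in> real_of_int ` C"
proof -
  let ?R = "map_poly real_of_int"
  have mult: "?R (r * s) = ?R r * ?R s" for r s
    by (rule poly_eqI) (simp add: coeff_map_poly coeff_mult)
  have "pderiv (?R p) = ?R (pderiv p)"
    by (rule poly_eqI) (simp add: coeff_map_poly coeff_pderiv)
  also have "\<dots> = smult (of_int \<kappa>) (?R (\<Prod>c\<in>C. [:-c, 1:]))"
    unfolding p by (rule poly_eqI) (simp add: coeff_map_poly)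
  also have "?R (\<Prod>c\<in>C. [:-c, 1:]) = (\<Prod>c\<in>C. [:- real_of_int c, 1:])"
    using C by (induction rule: finite_induct) (simp_all add: mult map_poly_pCons del: mult_pCons_left mult_pCons_right)
  finally show ?thesis using C \<kappa> by (auto simp: poly_prod)
qed

lemma poly_map_poly_of_int: "poly (map_poly real_of_int p) (real_of_int x) = real_of_int (poly p x)"
  by (induction p) (simp_all add: map_poly_pCons)

text \<open>Serves both halves of the theorem: for the given \<open>q\<close>, and for a rate above
  an allegedly sufficient \<open>\<beta>0\<close>.\<close>

lemma sard_counterexample:
  fixes d :: nat and q :: real
  assumes separable: "\<exists>D::('a::{real_inner,complete_space}) set. countable D \<and> closure D = UNIV"
    and infdim: "\<not> (\<exists>B::('a::{real_inner,complete_space}) set. finite B \<and> span B = UNIV)"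
    and d3: "d \<ge> 3"
    and q1: "1 < q" and q2: "q < (real d - 1) powr (1 / real d)"
  shows "\<exists>f :: 'a::{real_inner,complete_space} \<Rightarrow> real ^ 'm. f \<in> Pclass d
           \<and> (\<forall>r>0. compact (Crit f \<inter> cball 0 r)
                   \<and> limsup (\<lambda>n. ereal (kwidth n (Crit f \<inter> cball 0 r) powr (1 / real n)))
                       \<le> ereal (1 / q))
           \<and> (\<exists>r>0. emeasure lebesgue (f ` (Crit f \<inter> cball 0 r)) > 0)"
proof -
  obtain e :: "nat \<Rightarrow> 'a" where e: "orthonormal_total e"
    using exists_orthonormal_total[OF separable infdim] .
  have on: "e i \<bullet> e j = (if i = j then 1 else 0)" for i j using e by (simp add: orthonormal_total_def)
  obtain p :: "int poly" and \<kappa> C where p: "\<kappa> \<noteq> 0" "finite C" "card C = d - 1" "degree p = Suc (d - 1)"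
      "pderiv p = smult \<kappa> (\<Prod>c\<in>C. [:-c, 1:])" "inj_on (poly p) C"
    using exists_poly_distinct_critical_values[of "d - 1"] by blast
  define V where "V = poly p ` C"
  have V: "finite V" "card V = d - 1" using p by (auto simp: V_def card_image)
  have qd: "q ^ d < real d - 1"
  proof -
    have "q ^ d < ((real d - 1) powr (1 / real d)) ^ d"
      using q1 q2 d3 by (intro power_strict_mono) auto
    also have "\<dots> = real d - 1" using d3 by (simp add: powr_powr flip: powr_realpow)
    finally show ?thesis .
  qed
  \<comment> \<open>The midpoint leaves room on both sides: \<open>\<eta> < card V\<close> gives
    expansion weights, and \<open>q ^ d < \<eta>\<close> makes \<open>a k * (q ^ k) ^ d\<close>
    summable.\<close>
  define \<eta> where "\<eta> = (q ^ d + (real d - 1)) / 2"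
  have qd1: "1 < q ^ d" using q1 d3 by (simp add: one_less_power)
  have \<eta>: "1 < \<eta>" "q ^ d < \<eta>" "\<eta> < card V" using qd qd1 d3 V(2) by (auto simp: \<eta>_def of_nat_diff)
  have cV: "card V \<ge> 2" using V(2) d3 by simp
  obtain a :: "nat \<Rightarrow> real" and c where a: "\<And>k. 0 < a k" "\<And>k. a k \<le> c * (1 / \<eta>) ^ k"
    and dense: "\<And>x \<epsilon>. \<epsilon> > 0 \<Longrightarrow>
      \<exists>w (z::int). (\<forall>k. w k \<in> V) \<and> \<bar>(\<Sum>k. a k * real_of_int (w k)) - (x + z)\<bar> < \<epsilon>"
    using exists_expansion_weights[OF V(1) cV \<eta>(1,3)] by blast
  have a0: "a k \<ge> 0" for k using a(1)[of k] by simp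
  have sum\<gamma>: "summable (\<lambda>k. a k * (q ^ k) ^ d)"
  proof (rule summable_comparison_test'[where N=0])
    show "summable (\<lambda>k. c * (q ^ d / \<eta>) ^ k)"
      using \<eta> qd1 by (intro summable_mult summable_geometric) auto
    fix k
    have "a k * (q ^ k) ^ d \<le> c * (1 / \<eta>) ^ k * (q ^ k) ^ d"
      using a(2) q1 by (intro mult_right_mono) auto
    also have "\<dots> = c * (q ^ d / \<eta>) ^ k"
      by (simp add: power_divide power_mult[symmetric] mult.commute)
    finally show "norm (a k * (q ^ k) ^ d) \<le> c * (q ^ d / \<eta>) ^ k" using a0 q1 by simp
  qed
  have suma: "summable a"
  proof (rule summable_comparison_test'[where N=0, OF sum\<gamma>])
    show "norm (a k) \<le> a k * (q ^ k) ^ d" for k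
      using mult_left_mono[of 1 "(q ^ k) ^ d" "a k"] a0[of k] q1 by simp
  qed
  define rp where "rp = map_poly real_of_int p"
  have deg: "degree rp \<le> d" using p(4) d3 unfolding rp_def by (intro degree_le) (simp add: coeff_map_poly coeff_eq_0)
  define M where "M = CARD('m) - 1"
  obtain i0 :: 'm where True by blast
  have "card (UNIV - {i0}) = card {..<M}" by (simp add: M_def)
  then obtain \<pi> where \<pi>: "bij_betw \<pi> (UNIV - {i0}) {..<M}"
    by (metis finite_lessThan finite bij_betw_iff_card finite_Diff finite_UNIV)
  have d2: "d \<ge> 2" using d3 by simp
  have on': "e (i + M) \<bullet> e (j + M) = (if i = j then 1 else 0)" for i j by (simp add: on)
  interpret diagonal_series "\<lambda>k. e (k + M)" "\<lambda>k y. a k * poly rp (q ^ k * y)"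
    "\<lambda>k y. a k * q ^ k * poly (pderiv rp) (q ^ k * y)" "\<lambda>k. a k * (q ^ k) ^ d"
    "\<lambda>R. (\<Sum>i\<le>d. \<bar>coeff rp i\<bar> + \<bar>coeff (pderiv rp) i\<bar> + \<bar>coeff (pderiv (pderiv rp)) i\<bar>) * (max 1 R) ^ d"
    by (rule diagonal_series_poly[OF on' deg d2 less_imp_le[OF q1] a0 sum\<gamma>])
  interpret suspended_series e M "\<lambda>k y. a k * poly rp (q ^ k * y)"
    "\<lambda>k y. a k * q ^ k * poly (pderiv rp) (q ^ k * y)" "\<lambda>k. a k * (q ^ k) ^ d"
    "\<lambda>R. (\<Sum>i\<le>d. \<bar>coeff rp i\<bar> + \<bar>coeff (pderiv rp) i\<bar> + \<bar>coeff (pderiv (pderiv rp)) i\<bar>) * (max 1 R) ^ d"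
    i0 \<pi>
    by unfold_locales (rule on, rule \<pi>)
  have "restr_poly F d"
  proof (rule restr_poly_vecI)
    fix i
    have "restr_poly val d"
      unfolding val_def using restr_poly_series[OF norm_u deg less_imp_le[OF q1] a0 sum\<gamma>] by simp
    then show "restr_poly (\<lambda>x. F x $ i) d"
      using d3 by (cases "i = i0") (simp_all add: F_def restr_poly_inner)
  qed
  then have P: "F \<in> Pclass d" by (rule F_in_Pclass)
  have crit: "Crit F = {x. \<forall>k. q ^ k * (x \<bullet> e (k + M)) \<in> real_of_int ` C}"
  proof -
    have "a k * q ^ k * poly (pderiv rp) y = 0 \<longleftrightarrow> y \<in> real_of_int ` C" for k y
      using a(1)[of k] q1 real_poly_critical_points[OF p(5,2,1), of y] by (simp add: rp_def)
    then show ?thesis by (simp only: Crit_F)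
  qed
  have "closed (Crit F)"
  proof -
    have "Crit F = (\<Inter>k. (\<lambda>x. q ^ k * (x \<bullet> e (k + M))) -` (real_of_int ` C))" by (auto simp: crit)
    moreover have "closed ((\<lambda>x. q ^ k * (x \<bullet> e (k + M))) -` (real_of_int ` C))" for k
      using p(2) by (intro closed_vimage finite_imp_closed continuous_intros) auto
    ultimately show ?thesis by auto
  qed
  obtain C0 where C0: "\<And>c. c \<in> C \<Longrightarrow> \<bar>real_of_int c\<bar> \<le> C0" "C0 > 0"
  proof -
    have "bounded (real_of_int ` C)" using p(2) by (simp add: finite_imp_bounded)
    then show ?thesis using that unfolding bounded_pos by auto
  qed
  \<comment> \<open>The factor \<open>q ^ M\<close> compensates for the index shift between
    \<open>e (k + M)\<close> and \<open>q ^ k\<close>; \<open>r\<close> bounds the first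
    \<open>M\<close> coordinates and \<open>C0\<close> bounds the critical points.\<close>
  define \<beta> where "\<beta> = (\<lambda>r. (C0 + r) * q ^ M)"
  have tail: "\<bar>y j\<bar> \<le> \<beta> r * (1 / q) ^ j"
    if r: "r > 0" and y: "\<And>j. j < M \<Longrightarrow> \<bar>y j\<bar> \<le> r" "\<And>k. q ^ k * y (k + M) \<in> real_of_int ` C" for y j r
  proof (cases "j < M")
    case True
    have "\<bar>y j\<bar> \<le> (C0 + r) * 1" using y(1)[OF True] C0(2) by simp
    also have "\<dots> \<le> (C0 + r) * (q ^ (M - j))" using q1 r C0(2) by (intro mult_left_mono) auto
    also have "\<dots> = \<beta> r * (1 / q) ^ j" using True q1 by (simp add: \<beta>_def power_diff power_divide)
    finally show ?thesis .
  next
    case False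
    then obtain k where k: "j = k + M" by (metis add.commute le_Suc_ex not_less)
    have "\<bar>q ^ k * y j\<bar> \<le> C0 + r" using y(2)[of k] C0(1) r k by force
    then have "\<bar>y j\<bar> \<le> (C0 + r) / q ^ k" using q1 by (simp add: abs_mult field_simps)
    then show ?thesis using q1 by (simp add: k \<beta>_def power_add power_divide)
  qed
  have sub: "Crit F \<inter> cball 0 r \<subseteq> {x. \<forall>k. \<bar>x \<bullet> e k\<bar> \<le> \<beta> r * (1 / q) ^ k}" if "r > 0" for r
  proof clarify
    fix x k assume x: "x \<in> Crit F" "x \<in> cball 0 r"
    show "\<bar>x \<bullet> e k\<bar> \<le> \<beta> r * (1 / q) ^ k"
    proof (rule tail[OF that, of "\<lambda>k. x \<bullet> e k"])
      show "\<bar>x \<bullet> e j\<bar> \<le> r" for j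
        using Cauchy_Schwarz_ineq2[of x "e j"] x(2) on[of j j] by (simp add: norm_eq_sqrt_inner[of "e j"])
      show "q ^ k * (x \<bullet> e (k + M)) \<in> real_of_int ` C" for k using x(1) by (simp add: crit)
    qed
  qed
  have sum\<beta>: "summable (\<lambda>k. \<beta> r * (1 / q) ^ k)" for r
    using q1 by (intro summable_mult summable_geometric) auto
  have comp: "compact (Crit F \<inter> cball 0 r)" if "r > 0" for r
  proof -
    have "Crit F \<inter> cball 0 r = {x. \<forall>k. \<bar>x \<bullet> e k\<bar> \<le> \<beta> r * (1 / q) ^ k} \<inter> (Crit F \<inter> cball 0 r)"
      using sub[OF that] by blast
    also have "compact \<dots>"
      using \<open>closed (Crit F)\<close> by (intro compact_Int_closed compact_orthonormal_box[OF e sum\<beta>] closed_Int closed_cball)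
    finally show ?thesis .
  qed
  have width: "limsup (\<lambda>n. ereal (kwidth n (Crit F \<inter> cball 0 r) powr (1 / real n))) \<le> ereal (1 / q)"
    if "r > 0" for r
  proof -
    have \<beta>0: "\<beta> r > 0" using that C0(2) q1 by (simp add: \<beta>_def)
    show ?thesis
      using kwidth_geometric_box[OF e q1 sub[OF that] less_imp_le[OF \<beta>0]] \<beta>0 q1
      by (intro limsup_root_geometric_le[where c="\<beta> r / (1 - 1 / q)"]) auto
  qed
  \<comment> \<open>Large enough for the ball to contain every critical point built below; their
    first \<open>M\<close> coordinates lie in \<open>[0, 1]\<close>, hence
    \<open>\<beta> 1\<close>.\<close>
  define r where "r = (\<Sum>k. \<beta> 1 * (1 / q) ^ k) + 1"
  have r: "r > 0"
    unfolding r_def using C0(2) q1 by (intro add_nonneg_pos suminf_nonneg sum\<beta>) (auto simp: \<beta>_def)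
  define K where "K = Crit F \<inter> cball 0 r"
  have contF: "continuous_on UNIV F"
    using F_has_derivative by (meson has_derivative_continuous continuous_at_imp_continuous_on)
  have FK: "compact (F ` K)"
    unfolding K_def using comp[OF r] contF by (meson compact_continuous_image continuous_on_subset subset_UNIV)
  obtain W where W: "\<And>w. (\<forall>k. w k \<in> V) \<Longrightarrow> \<bar>\<Sum>k. a k * real_of_int (w k)\<bar> \<le> W"
  proof -
    obtain b where b: "\<And>v. v \<in> V \<Longrightarrow> \<bar>real_of_int v\<bar> \<le> b"
      using V(1) by (metis finite_imageI finite_imp_bounded bounded_iff imageI real_norm_def)
    have "\<bar>\<Sum>k. a k * real_of_int (w k)\<bar> \<le> (\<Sum>k. a k * b)" if "\<forall>k. w k \<in> V" for w
      unfolding real_norm_def[symmetric]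
    proof (rule norm_suminf_le)
      show "norm (a k * real_of_int (w k)) \<le> a k * b" for k
        using that b a0[of k] by (simp add: abs_mult mult_left_mono)
      show "summable (\<lambda>k. a k * b)" by (rule summable_mult2[OF suma])
    qed
    then show ?thesis by (rule that)
  qed
  \<comment> \<open>If a digit sum is within 1 of \<open>t $ i0 + z\<close> with
    \<open>t $ i0\<close> in \<open>[0, 1]\<close>, then the absolute value of \<open>z\<close> is
    below \<open>W + 2\<close>. Finitely many translates therefore suffice.\<close>
  define Z where "Z = \<lceil>W\<rceil> + 2"
  define T where "T = (\<Union>z\<in>{-Z..Z}. (+) (- of_int z *\<^sub>R axis i0 1) ` (F ` K))"
  have box: "cbox 0 1 \<subseteq> T"
  proof
    fix t :: "real ^ 'm" assume t: "t \<in> cbox 0 1"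
    have t01: "0 \<le> t $ i" "t $ i \<le> 1" for i using t by (auto simp: mem_box_cart)
    \<comment> \<open>Approximation is enough, because \<open>T\<close> is a finite union of compact
      sets and hence closed. The tolerance \<open>min 1 \<epsilon>\<close> keeps the range of
      \<open>z\<close> independent of \<open>\<epsilon>\<close>.\<close>
    have "\<exists>y\<in>T. dist y t < \<epsilon>" if \<epsilon>: "\<epsilon> > 0" for \<epsilon>
    proof -
      obtain w z where w: "\<forall>k. w k \<in> V"
        and wz: "\<bar>(\<Sum>k. a k * real_of_int (w k)) - (t $ i0 + real_of_int z)\<bar> < min 1 \<epsilon>"
        using dense[of "min 1 \<epsilon>" "t $ i0"] \<epsilon> by auto
      have "\<bar>real_of_int z\<bar> < W + 2" using wz W[OF w] t01[of i0] by linarith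
      then have z: "z \<in> {-Z..Z}" unfolding Z_def by simp linarith
      have "\<forall>k. \<exists>c\<in>C. poly p c = w k" using w unfolding V_def by (metis imageE)
      then obtain ck where ck: "\<And>k. ck k \<in> C" "\<And>k. poly p (ck k) = w k" by metis
      \<comment> \<open>The first \<open>M\<close> coordinates reproduce the components of
        \<open>t\<close> other than \<open>i0\<close> exactly; the others are rescaled critical
        points of \<open>p\<close> with values \<open>w\<close>.\<close>
      define y where "y = (\<lambda>j. if j < M then t $ (inv_into (UNIV - {i0}) \<pi> j) else real_of_int (ck (j - M)) / q ^ (j - M))"
      have yM: "q ^ k * y (k + M) = real_of_int (ck k)" for k using q1 by (simp add: y_def)
      have yb: "\<bar>y j\<bar> \<le> \<beta> 1 * (1 / q) ^ j" for j
      proof (rule tail)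
        show "\<bar>y j\<bar> \<le> 1" if "j < M" for j using that t01 by (simp add: y_def)
        show "q ^ k * y (k + M) \<in> real_of_int ` C" for k using yM ck(1) by simp
      qed simp
      define x where "x = (\<Sum>k. y k *\<^sub>R e k)"
      have xe: "x \<bullet> e j = y j" for j unfolding x_def by (rule orthonormal_series(3)[OF e yb sum\<beta>])
      have "norm x \<le> r" unfolding x_def r_def using orthonormal_series(2)[OF e yb sum\<beta>] by simp
      moreover have "x \<in> Crit F" using ck(1) by (auto simp: crit xe yM)
      ultimately have xK: "x \<in> K" by (simp add: K_def)
      have "val x = (\<Sum>k. a k * real_of_int (w k))"
        unfolding val_def xe yM by (simp add: rp_def poly_map_poly_of_int ck(2))
      then have F0: "F x $ i0 = (\<Sum>k. a k * real_of_int (w k))" by (simp add: F_def)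
      have Fi: "F x $ i = t $ i" if "i \<noteq> i0" for i
      proof -
        have "\<pi> i < M" "inv_into (UNIV - {i0}) \<pi> (\<pi> i) = i"
          using \<pi> that by (auto simp: bij_betw_def inv_into_f_f)
        then show ?thesis using that by (simp add: F_def xe y_def)
      qed
      have "- of_int z *\<^sub>R axis i0 1 + F x - t = (F x $ i0 - (t $ i0 + z)) *\<^sub>R axis i0 1"
        using Fi by (auto simp: vec_eq_iff axis_def)
      then have "dist (- of_int z *\<^sub>R axis i0 1 + F x) t < \<epsilon>"
        using wz by (simp add: dist_norm F0)
      moreover have "- of_int z *\<^sub>R axis i0 1 + F x \<in> T" unfolding T_def using z xK by blast
      ultimately show ?thesis by blast
    qed
    then have "t \<in> closure T" by (simp add: closure_approachable)
    moreover have "compact T" unfolding T_def using FK by (intro compact_UN compact_translation) auto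
    ultimately show "t \<in> T" using compact_imp_closed closure_closed by blast
  qed
  \<comment> \<open>Otherwise the finitely many translates would be null and could not cover the
    unit cube.\<close>
  have "\<not> negligible (F ` K)"
  proof
    assume "negligible (F ` K)"
    then have "negligible T" unfolding T_def
      by (intro negligible_Union) (simp, elim imageE, simp only: negligible_translation)
    then have "negligible (cbox (0::real ^ 'm) 1)" using box negligible_subset by blast
    moreover have "(\<chi> i. 1/2) \<in> box (0::real ^ 'm) 1" by (simp add: mem_box_cart)
    ultimately show False by (auto simp: negligible_interval)
  qed
  \<comment> \<open>Compactness supplies measurability, without which \<open>emeasure\<close> would
    be 0 by convention.\<close>
  then have "emeasure lebesgue (F ` K) > 0"
    using lmeasurable_compact[OF FK] by (auto simp: negligible_iff_null_sets null_sets_def zero_less_iff_neq_zero)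
  then show ?thesis using P comp width r unfolding K_def by (intro exI[of _ F]) blast
qed

text \<open>The existence of a Hilbert space is obtained in a strong form: any separable
  infinite-dimensional type \<open>'a\<close> serves. The Sard property for \<open>\<beta>0\<close>
  is assumed on \<open>'a\<close> alone, which strengthens the lower bound.\<close>

theorem theoremB:
  fixes d :: nat and q :: real
  assumes separable: "\<exists>D::('a::{real_inner,complete_space}) set. countable D \<and> closure D = UNIV"
    and infdim: "\<not> (\<exists>B::'a set. finite B \<and> span B = UNIV)"
    and d3: "d \<ge> 3"
    and q1: "1 < q" and q2: "q < (real d - 1) powr (1 / real d)"
  shows "(\<exists>f :: 'a \<Rightarrow> real ^ 'm. f \<in> Pclass d
           \<and> (\<forall>r>0. compact (Crit f \<inter> cball 0 r)
                   \<and> limsup (\<lambda>n. ereal (kwidth n (Crit f \<inter> cball 0 r) powr (1 / real n)))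
                       \<le> ereal (1 / q))
           \<and> (\<exists>r>0. emeasure lebesgue (f ` (Crit f \<inter> (Crit f \<inter> cball 0 r))) > 0))
       \<and> (\<forall>\<beta>0 :: real. \<beta>0 > 1 \<longrightarrow>
            (\<forall>(K::'a set) (q'::real) (g :: 'a \<Rightarrow> real ^ 'm).
                compact K \<longrightarrow> q' > \<beta>0 \<longrightarrow>
                limsup (\<lambda>n. ereal (kwidth n K powr (1 / real n))) \<le> ereal (1 / q') \<longrightarrow>
                g \<in> Pclass d \<longrightarrow> g ` (Crit g \<inter> K) \<in> null_sets lebesgue)
            \<longrightarrow> \<beta>0 \<ge> (real d - 1) powr (1 / real d))"
proof (intro conjI allI impI)
  have idem: "Crit f \<inter> (Crit f \<inter> S) = Crit f \<inter> S" for f :: "'a \<Rightarrow> real ^ 'm" and S by blast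
  show "\<exists>f :: 'a \<Rightarrow> real ^ 'm. f \<in> Pclass d
           \<and> (\<forall>r>0. compact (Crit f \<inter> cball 0 r)
                   \<and> limsup (\<lambda>n. ereal (kwidth n (Crit f \<inter> cball 0 r) powr (1 / real n)))
                       \<le> ereal (1 / q))
           \<and> (\<exists>r>0. emeasure lebesgue (f ` (Crit f \<inter> (Crit f \<inter> cball 0 r))) > 0)"
    unfolding idem by (rule sard_counterexample[OF assms])
  fix \<beta>0 :: real
  assume \<beta>0: "\<beta>0 > 1" and sard: "\<forall>(K::'a set) (q'::real) (g :: 'a \<Rightarrow> real ^ 'm).
                compact K \<longrightarrow> q' > \<beta>0 \<longrightarrow>
                limsup (\<lambda>n. ereal (kwidth n K powr (1 / real n))) \<le> ereal (1 / q') \<longrightarrow>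
                g \<in> Pclass d \<longrightarrow> g ` (Crit g \<inter> K) \<in> null_sets lebesgue"
  show "\<beta>0 \<ge> (real d - 1) powr (1 / real d)"
  proof (rule ccontr)
    assume "\<not> ?thesis"
    \<comment> \<open>A rate strictly between \<open>\<beta>0\<close> and the threshold: its
      counterexample meets all conditions of the assumed Sard property, yet its image has positive
      measure.\<close>
    then obtain q' where q': "\<beta>0 < q'" "q' < (real d - 1) powr (1 / real d)"
      using dense not_le by metis
    then have "1 < q'" using \<beta>0 by simp
    from sard_counterexample[OF separable infdim d3 this q'(2), where 'm='m]
    obtain f :: "'a \<Rightarrow> real ^ 'm" and r where f: "f \<in> Pclass d" "r > 0" "compact (Crit f \<inter> cball 0 r)"
        "limsup (\<lambda>n. ereal (kwidth n (Crit f \<inter> cball 0 r) powr (1 / real n))) \<le> ereal (1 / q')"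
        "emeasure lebesgue (f ` (Crit f \<inter> cball 0 r)) > 0" by blast
    have "f ` (Crit f \<inter> (Crit f \<inter> cball 0 r)) \<in> null_sets lebesgue"
      using sard f(1,3,4) q'(1) by blast
    then show False using f(5) unfolding idem by (auto dest: null_setsD1)
  qed
qed

end
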